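(* Let $\mathfrak g$ be a basic Lie superalgebra over $\mathbb C$ and $e\in\mathfrak g_{\bar0}$ nilpotent such that $d_1=\dim\mathfrak g_{\bar1}-\dim\mathfrak g^e_{\bar1}$ is odd. Then any two-dimensional (hence irreducible of minimal dimension) $U(\mathfrak g,e)$-module, regarded by restriction as a module over the refined finite $W$-superalgebra $W'_\chi=Q_\chi^{\operatorname{ad}\mathfrak m'}\subseteq U(\mathfrak g,e)$, is a $W'_\chi$-module of type $Q$.
   Context: Conventions. All vector spaces, algebras and modules are $\mathbb Z_2$-graded; $\dim V=\dim V_{\bar0}+\dim V_{\bar1}$. By the super Schur lemma the endomorphism ring of an irreducible module is one-dimensional (type $M$) or two-dimensional (type $Q$; it then contains an odd automorphism, where an odd endomorphism $\tau$ satisfies $\tau(av)=(-1)^{|a|}a\tau(v)$). Basic Lie superalgebras over $\mathbb C$: $\mathfrak{gl}(m|n)$, $\mathfrak{sl}(m|n)$ with $m\neq n$, $\mathfrak{osp}(m|n)$, $D(2,1;a)$ with $a$ algebraic, $F(4)$, $G(3)$. Each has an even non-degenerate supersymmetric invariant bilinear form $(\cdot,\cdot)$. Finite $W$-superalgebra. Fix an $\mathfrak{sl}_2$-triple $(e,h,f)$ in $\mathfrak g_{\bar0}$, normalise the form by $(e,f)=1$, put $\chi=(e,\cdot)\in\mathfrak g^*$, $\mathfrak g(i)=\{x:[h,x]=ix\}$, $\mathfrak g^e=\ker\operatorname{ad}e$. On $\mathfrak g(-1)_{\bar0}$ (resp. $\mathfrak g(-1)_{\bar1}$) the form $\langle x,y\rangle=\chi([x,y])$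 is symplectic (resp. symmetric) non-degenerate; choose bases $u_1,\dots,u_{2s}$ with $\langle u_i,u_j\rangle=i^*\delta_{i+j,2s+1}$ ($i^*=-1$ for $i\le s$, $i^*=1$ for $i>s$), and $v_1,\dots,v_r$ with $\langle v_i,v_j\rangle=\delta_{i+j,r+1}$; $r$ has the same parity as $d_1$, so it is odd here. Let $\mathfrak m=\bigoplus_{i\le-2}\mathfrak g(i)\oplus\operatorname{span}\{u_{s+1},\dots,u_{2s}\}\oplus\operatorname{span}\{v_j:j>\frac{r+1}{2}\}$ and $\mathfrak m'=\mathfrak m\oplus\mathbb Cv_{\frac{r+1}{2}}$. $\chi$ restricts to a character of $\mathfrak m$; $Q_\chi=U(\mathfrak g)\otimes_{U(\mathfrak m)}\mathbb C_\chi\cong U(\mathfrak g)/I_\chi$, with $I_\chi$ the left ideal generated by all $x-\chi(x)$, $x\in\mathfrak m$. $U(\mathfrak g,e)=(\operatorname{End}_{\mathfrak g}Q_\chi)^{\mathrm{op}}$, identified with the algebra $Q_\chi^{\operatorname{ad}\mathfrak m}$ of $\operatorname{ad}\mathfrak m$-invariants (product $(x+I_\chi)(y+I_\chi)=xy+I_\chi$); $W'_\chi=Q_\chi^{\operatorname{ad}\mathfrak m'}$ is the subalgebra of $\operatorname{ad}\mathfrak m'$-invariants.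
   Formalization: The restriction to W'_χ always has an odd automorphism, but it is claimed to be of type Q (irreducible, two-dimensional endomorphism ring) only if some odd element of W'_χ acts non-trivially; otherwise it is reducible, as happens for osp(1|2) with e regular. *)

theory Defs
  imports
    Complex_Main
    "HOL-Library.Z2"
    "HOL-Library.Poly_Mapping"
    "HOL-Library.Function_Algebras"
    "HOL-Computational_Algebra.Polynomial"
    "HOL-Algebra.QuotRing"
    "HOL-Algebra.Module"
    "Jordan_Normal_Form.Matrix"
begin

section \<open>Super vector spaces\<close>

text \<open>Parities are elements of the two-element field \<^typ>\<open>bit\<close>, so that parities add modulo 2.\<close>

definition koszul :: "bit \<Rightarrow> bit \<Rightarrow> complex" where
  "koszul p q = (if p = 1 \<and> q = 1 then -1 else 1)"

locale super_space = vector_space scale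
  for scale :: "complex \<Rightarrow> 'a::ab_group_add \<Rightarrow> 'a" +
  fixes part :: "bit \<Rightarrow> 'a set"
  assumes subspace_part: "subspace (part p)"
    and part_disjoint: "part 0 \<inter> part 1 = {0}"
    and part_decomp: "\<exists>a\<in>part 0. \<exists>b\<in>part 1. x = a + b"

section \<open>Lie superalgebras\<close>

record 'g lie_super =
  lscale :: "complex \<Rightarrow> 'g \<Rightarrow> 'g"
  lpart :: "bit \<Rightarrow> 'g set"
  lbr :: "'g \<Rightarrow> 'g \<Rightarrow> 'g"

abbreviation lspan :: "'g::ab_group_add lie_super \<Rightarrow> 'g set \<Rightarrow> 'g set" where
  "lspan L \<equiv> module.span (lscale L)"

abbreviation ldim :: "'g::ab_group_add lie_super \<Rightarrow> 'g set \<Rightarrow> nat" where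
  "ldim L \<equiv> vector_space.dim (lscale L)"

definition lie_superalgebra :: "'g::ab_group_add lie_super \<Rightarrow> bool" where
  "lie_superalgebra L \<longleftrightarrow>
     super_space (lscale L) (lpart L) \<and>
     (\<forall>x. Vector_Spaces.linear (lscale L) (lscale L) (lbr L x)) \<and>
     (\<forall>y. Vector_Spaces.linear (lscale L) (lscale L) (\<lambda>x. lbr L x y)) \<and>
     (\<forall>p q. \<forall>x\<in>lpart L p. \<forall>y\<in>lpart L q. lbr L x y \<in> lpart L (p + q)) \<and>
     (\<forall>p q. \<forall>x\<in>lpart L p. \<forall>y\<in>lpart L q.
        lbr L x y = lscale L (- koszul p q) (lbr L y x)) \<and>
     (\<forall>p q. \<forall>x\<in>lpart L p. \<forall>y\<in>lpart L q. \<forall>z.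
        lbr L x (lbr L y z) = lbr L (lbr L x y) z + lscale L (koszul p q) (lbr L y (lbr L x z)))"

definition finite_dimensional :: "'g::ab_group_add lie_super \<Rightarrow> bool" where
  "finite_dimensional L \<longleftrightarrow> (\<exists>S. finite S \<and> lspan L S = UNIV)"

subsection \<open>The matrix families\<close>

text \<open>In \<open>gl(m|n)\<close> the first \<open>m\<close> basis vectors are even and the last \<open>n\<close> are odd.\<close>

definition index_parity :: "nat \<Rightarrow> nat \<Rightarrow> bit" where
  "index_parity m i = (if i < m then 0 else 1)"

definition gl_part :: "nat \<Rightarrow> nat \<Rightarrow> bit \<Rightarrow> complex mat set" where
  "gl_part m n p = {A \<in> carrier_mat (m + n) (m + n). \<forall>i<m + n. \<forall>j<m + n.
      A $$ (i, j) \<noteq> 0 \<longrightarrow> index_parity m i + index_parity m j = p}"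

definition supertrace :: "nat \<Rightarrow> nat \<Rightarrow> complex mat \<Rightarrow> complex" where
  "supertrace m n A = (\<Sum>i<m. A $$ (i, i)) - (\<Sum>i\<in>{m..<m + n}. A $$ (i, i))"

definition sl_part :: "nat \<Rightarrow> nat \<Rightarrow> bit \<Rightarrow> complex mat set" where
  "sl_part m n p = {A \<in> gl_part m n p. supertrace m n A = 0}"

text \<open>The Gram matrix of the standard even non-degenerate supersymmetric form \<open>\<beta>\<close> on
  the space of dimension \<open>(m|2k)\<close>: symmetric on the even part, symplectic on the odd part.\<close>

definition osp_gram :: "nat \<Rightarrow> nat \<Rightarrow> complex mat" where
  "osp_gram m k = mat (m + 2 * k) (m + 2 * k) (\<lambda>(i, j).
      if i < m then (if i = j then 1 else 0)
      else if j < m then 0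
      else if j = i + k then 1
      else if i = j + k then -1
      else 0)"

text \<open>\<open>osp(m|2k)\<close> in parity \<open>p\<close> consists of those \<open>A\<close> with
  \<open>\<beta>(A x, y) + (-1)\<^bsup>p|x|\<^esup> \<beta>(x, A y) = 0\<close>; below, \<open>x\<close> and \<open>y\<close> run through the standard basis.\<close>

definition osp_part :: "nat \<Rightarrow> nat \<Rightarrow> bit \<Rightarrow> complex mat set" where
  "osp_part m k p = {A \<in> gl_part m (2 * k) p. \<forall>i<m + 2 * k. \<forall>j<m + 2 * k.
      (transpose_mat A * osp_gram m k) $$ (i, j)
        + koszul p (index_parity m i) * (osp_gram m k * A) $$ (i, j) = 0}"

text \<open>\<open>L\<close> is isomorphic to the Lie superalgebra whose homogeneous parts are the sets of
  matrices \<open>M 0\<close> and \<open>M 1\<close>, with the supercommutator as bracket.\<close>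

definition iso_matrix_lie ::
    "'g::ab_group_add lie_super \<Rightarrow> (bit \<Rightarrow> complex mat set) \<Rightarrow> bool" where
  "iso_matrix_lie L M \<longleftrightarrow> (\<exists>\<phi>.
     (\<forall>x y. \<phi> (x + y) = \<phi> x + \<phi> y) \<and>
     (\<forall>c x. \<phi> (lscale L c x) = c \<cdot>\<^sub>m \<phi> x) \<and>
     (\<forall>p. bij_betw \<phi> (lpart L p) (M p)) \<and>
     (\<forall>p q. \<forall>x\<in>lpart L p. \<forall>y\<in>lpart L q.
        \<phi> (lbr L x y) = \<phi> x * \<phi> y - koszul p q \<cdot>\<^sub>m (\<phi> y * \<phi> x)))"

subsection \<open>The exceptional algebras, after Kac\<close>

definition lie_ideal :: "'g::ab_group_add lie_super \<Rightarrow> 'g set \<Rightarrow> bool" where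
  "lie_ideal L I \<longleftrightarrow> module.subspace (lscale L) I \<and>
     (\<forall>x\<in>I. \<exists>a\<in>I \<inter> lpart L 0. \<exists>b\<in>I \<inter> lpart L 1. x = a + b) \<and>
     (\<forall>x. \<forall>y\<in>I. lbr L x y \<in> I)"

text \<open>The contragredient Lie superalgebra of a (non-singular) Cartan matrix \<open>A\<close> of size \<open>n\<close>
  with set \<open>\<tau>\<close> of odd simple roots: it has Chevalley generators, and no non-zero ideal meets
  the Cartan subalgebra trivially.\<close>

definition contragredient ::
    "'g::ab_group_add lie_super \<Rightarrow> nat \<Rightarrow> (nat \<Rightarrow> nat \<Rightarrow> complex) \<Rightarrow> nat set \<Rightarrow> bool" where
  "contragredient L n A \<tau> \<longleftrightarrow> (\<exists>E F H.
     (\<forall>i<n. H i \<in> lpart L 0 \<and>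
        E i \<in> lpart L (if i \<in> \<tau> then 1 else 0) \<and> F i \<in> lpart L (if i \<in> \<tau> then 1 else 0)) \<and>
     (\<forall>i<n. \<forall>j<n. lbr L (E i) (F j) = (if i = j then H i else 0) \<and>
        lbr L (H i) (H j) = 0 \<and>
        lbr L (H i) (E j) = lscale L (A i j) (E j) \<and>
        lbr L (H i) (F j) = lscale L (- A i j) (F j)) \<and>
     inj_on H {..<n} \<and> \<not> module.dependent (lscale L) (H ` {..<n}) \<and>
     (\<forall>S. module.subspace (lscale L) S \<and> (\<forall>x\<in>S. \<forall>y\<in>S. lbr L x y \<in> S) \<and>
        E ` {..<n} \<union> F ` {..<n} \<union> H ` {..<n} \<subseteq> S \<longrightarrow> S = UNIV) \<and>
     (\<forall>I. lie_ideal L I \<and> I \<inter> lspan L (H ` {..<n}) = {0} \<longrightarrow> I = {0}))"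

definition cartan_of_rows :: "complex list list \<Rightarrow> nat \<Rightarrow> nat \<Rightarrow> complex" where
  "cartan_of_rows rs i j = rs ! i ! j"

definition is_D21 :: "'g::ab_group_add lie_super \<Rightarrow> complex \<Rightarrow> bool" where
  "is_D21 L a \<longleftrightarrow> contragredient L 3 (cartan_of_rows
     [[ 0, 1, a],
      [-1, 2, 0],
      [-1, 0, 2]]) {0}"

definition is_F4 :: "'g::ab_group_add lie_super \<Rightarrow> bool" where
  "is_F4 L \<longleftrightarrow> contragredient L 4 (cartan_of_rows
     [[ 0,  1,  0,  0],
      [-1,  2, -2,  0],
      [ 0, -1,  2, -1],
      [ 0,  0, -1,  2]]) {0}"

definition is_G3 :: "'g::ab_group_add lie_super \<Rightarrow> bool" where
  "is_G3 L \<longleftrightarrow> contragredient L 3 (cartan_of_rows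
     [[ 0,  1,  0],
      [-1,  2, -3],
      [ 0, -1,  2]]) {0}"

text \<open>For \<open>a = 0\<close> and \<open>a = -1\<close> the algebra \<open>D(2,1;a)\<close> is not simple and is not a basic Lie
  superalgebra.\<close>

definition basic_lie_superalgebra :: "'g::ab_group_add lie_super \<Rightarrow> bool" where
  "basic_lie_superalgebra L \<longleftrightarrow> lie_superalgebra L \<and> finite_dimensional L \<and>
     ((\<exists>m n. iso_matrix_lie L (gl_part m n)) \<or>
      (\<exists>m n. m \<noteq> n \<and> iso_matrix_lie L (sl_part m n)) \<or>
      (\<exists>m k. iso_matrix_lie L (osp_part m k)) \<or>
      (\<exists>a. algebraic a \<and> a \<noteq> 0 \<and> a \<noteq> -1 \<and> is_D21 L a) \<or>
      is_F4 L \<or>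
      is_G3 L)"

definition invariant_form :: "'g::ab_group_add lie_super \<Rightarrow> ('g \<Rightarrow> 'g \<Rightarrow> complex) \<Rightarrow> bool" where
  "invariant_form L B \<longleftrightarrow>
     (\<forall>x. Vector_Spaces.linear (lscale L) (*) (B x)) \<and>
     (\<forall>y. Vector_Spaces.linear (lscale L) (*) (\<lambda>x. B x y)) \<and>
     (\<forall>p q. \<forall>x\<in>lpart L p. \<forall>y\<in>lpart L q. p \<noteq> q \<longrightarrow> B x y = 0) \<and>
     (\<forall>p q. \<forall>x\<in>lpart L p. \<forall>y\<in>lpart L q. B x y = koszul p q * B y x) \<and>
     (\<forall>x y z. B (lbr L x y) z = B x (lbr L y z)) \<and>
     (\<forall>x. (\<forall>y. B x y = 0) \<longrightarrow> x = 0)"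

section \<open>Superalgebras and their modules\<close>

record 'a superalg = "(complex, 'a) module" +
  apart :: "bit \<Rightarrow> 'a set"

text \<open>The underlying space of a module is the whole type \<^typ>\<open>'v\<close>; a module restricts to a
  subalgebra without any change of the record.\<close>

record ('a, 'v) supermod =
  mscale :: "complex \<Rightarrow> 'v \<Rightarrow> 'v"
  mpart :: "bit \<Rightarrow> 'v set"
  act :: "'a \<Rightarrow> 'v \<Rightarrow> 'v"

abbreviation mdim :: "('a, 'v::ab_group_add) supermod \<Rightarrow> nat" where
  "mdim V \<equiv> vector_space.dim (mscale V) UNIV"

definition supermodule :: "'a superalg \<Rightarrow> ('a, 'v::ab_group_add) supermod \<Rightarrow> bool" where
  "supermodule A V \<longleftrightarrow>
     super_space (mscale V) (mpart V) \<and>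
     (\<forall>x\<in>carrier A. Vector_Spaces.linear (mscale V) (mscale V) (act V x)) \<and>
     (\<forall>x\<in>carrier A. \<forall>y\<in>carrier A. \<forall>v. act V (x \<oplus>\<^bsub>A\<^esub> y) v = act V x v + act V y v) \<and>
     (\<forall>c. \<forall>x\<in>carrier A. \<forall>v. act V (c \<odot>\<^bsub>A\<^esub> x) v = mscale V c (act V x v)) \<and>
     (\<forall>x\<in>carrier A. \<forall>y\<in>carrier A. \<forall>v. act V (x \<otimes>\<^bsub>A\<^esub> y) v = act V x (act V y v)) \<and>
     (\<forall>v. act V \<one>\<^bsub>A\<^esub> v = v) \<and>
     (\<forall>p q. \<forall>x\<in>apart A p. \<forall>v\<in>mpart V q. act V x v \<in> mpart V (p + q))"

definition subsupermodule ::
    "'a superalg \<Rightarrow> ('a, 'v::ab_group_add) supermod \<Rightarrow> 'v set \<Rightarrow> bool" where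
  "subsupermodule A V N \<longleftrightarrow> module.subspace (mscale V) N \<and>
     (\<forall>v\<in>N. \<exists>a\<in>N \<inter> mpart V 0. \<exists>b\<in>N \<inter> mpart V 1. v = a + b) \<and>
     (\<forall>x\<in>carrier A. \<forall>v\<in>N. act V x v \<in> N)"

definition irreducible_supermodule ::
    "'a superalg \<Rightarrow> ('a, 'v::ab_group_add) supermod \<Rightarrow> bool" where
  "irreducible_supermodule A V \<longleftrightarrow> supermodule A V \<and> (UNIV :: 'v set) \<noteq> {0} \<and>
     (\<forall>N. subsupermodule A V N \<longrightarrow> N = {0} \<or> N = UNIV)"

definition End_part ::
    "'a superalg \<Rightarrow> ('a, 'v::ab_group_add) supermod \<Rightarrow> bit \<Rightarrow> ('v \<Rightarrow> 'v) set" where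
  "End_part A V p = {\<tau>. Vector_Spaces.linear (mscale V) (mscale V) \<tau> \<and>
     (\<forall>q. \<forall>v\<in>mpart V q. \<tau> v \<in> mpart V (p + q)) \<and>
     (\<forall>q. \<forall>x\<in>apart A q. \<forall>v. \<tau> (act V x v) = mscale V (koszul p q) (act V x (\<tau> v)))}"

definition End_super :: "'a superalg \<Rightarrow> ('a, 'v::ab_group_add) supermod \<Rightarrow> ('v \<Rightarrow> 'v) set" where
  "End_super A V = {\<sigma> + \<tau> | \<sigma> \<tau>. \<sigma> \<in> End_part A V 0 \<and> \<tau> \<in> End_part A V 1}"

definition odd_automorphism ::
    "'a superalg \<Rightarrow> ('a, 'v::ab_group_add) supermod \<Rightarrow> ('v \<Rightarrow> 'v) \<Rightarrow> bool" where
  "odd_automorphism A V \<tau> \<longleftrightarrow> \<tau> \<in> End_part A V 1 \<and> bij \<tau>"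

text \<open>Type Q is a property of irreducible modules. A two-dimensional module may have an odd
  automorphism without being of type Q: if the odd part of \<open>A\<close> acts by zero, each homogeneous
  part is a submodule.\<close>

definition type_Q :: "'a superalg \<Rightarrow> ('a, 'v::ab_group_add) supermod \<Rightarrow> bool" where
  "type_Q A V \<longleftrightarrow> irreducible_supermodule A V \<and>
     vector_space.dim (\<lambda>c (\<tau> :: 'v \<Rightarrow> 'v) v. mscale V c (\<tau> v)) (End_super A V) = 2"

section \<open>The universal enveloping superalgebra\<close>

text \<open>Words in the elements of \<open>\<gg>\<close>; the finitely supported functions on words form the free
  unital associative algebra on the set \<open>\<gg>\<close>.\<close>

datatype 'g free_word = Word (letters: "'g list")

instantiation free_word :: (type) monoid_add
begin

definition zero_free_word :: "'a free_word" where "zero_free_word = Word []"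

definition plus_free_word :: "'a free_word \<Rightarrow> 'a free_word \<Rightarrow> 'a free_word" where
  "plus_free_word v w = Word (letters v @ letters w)"

instance
  by standard (simp_all add: zero_free_word_def plus_free_word_def)

end

type_synonym 'g free_alg = "'g free_word \<Rightarrow>\<^sub>0 complex"
type_synonym 'g env = "'g free_alg set"

definition const :: "complex \<Rightarrow> 'g free_alg" where
  "const c = Poly_Mapping.single 0 c"

definition gen :: "'g \<Rightarrow> 'g free_alg" where
  "gen x = Poly_Mapping.single (Word [x]) 1"

definition free_ring :: "'g free_alg ring" where
  "free_ring = \<lparr>carrier = UNIV, mult = (*), one = 1, zero = 0, add = (+)\<rparr>"

text \<open>The first two families of relations make \<open>gen\<close> linear, which turns the free algebra on
  the set \<open>\<gg>\<close> into the tensor algebra of the vector space \<open>\<gg>\<close>.\<close>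

definition env_relations :: "'g::ab_group_add lie_super \<Rightarrow> 'g free_alg set" where
  "env_relations L =
     {gen (x + y) - (gen x + gen y) | x y. True} \<union>
     {gen (lscale L c x) - const c * gen x | c x. True} \<union>
     {gen x * gen y - const (koszul p q) * (gen y * gen x) - gen (lbr L x y) | x y p q.
        x \<in> lpart L p \<and> y \<in> lpart L q}"

definition env_ideal :: "'g::ab_group_add lie_super \<Rightarrow> 'g free_alg set" where
  "env_ideal L = genideal free_ring (env_relations L)"

definition env_ring :: "'g::ab_group_add lie_super \<Rightarrow> 'g env ring" where
  "env_ring L = free_ring Quot env_ideal L"

definition env_class :: "'g::ab_group_add lie_super \<Rightarrow> 'g free_alg \<Rightarrow> 'g env" where
  "env_class L t = env_ideal L +>\<^bsub>free_ring\<^esub> t"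

definition env_smult :: "'g::ab_group_add lie_super \<Rightarrow> complex \<Rightarrow> 'g env \<Rightarrow> 'g env" where
  "env_smult L c X = env_class L (const c) \<otimes>\<^bsub>env_ring L\<^esub> X"

definition env_embed :: "'g::ab_group_add lie_super \<Rightarrow> 'g \<Rightarrow> 'g env" where
  "env_embed L x = env_class L (gen x)"

inductive env_homogeneous :: "'g::ab_group_add lie_super \<Rightarrow> bit \<Rightarrow> 'g env \<Rightarrow> bool"
  for L where
  zero: "env_homogeneous L p \<zero>\<^bsub>env_ring L\<^esub>"
| one: "env_homogeneous L 0 \<one>\<^bsub>env_ring L\<^esub>"
| add: "env_homogeneous L p X \<Longrightarrow> env_homogeneous L p Y \<Longrightarrow> env_homogeneous L p (X \<oplus>\<^bsub>env_ring L\<^esub> Y)"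
| smult: "env_homogeneous L p X \<Longrightarrow> env_homogeneous L p (env_smult L c X)"
| embed: "x \<in> lpart L p \<Longrightarrow> env_homogeneous L q X \<Longrightarrow>
    env_homogeneous L (p + q) (env_embed L x \<otimes>\<^bsub>env_ring L\<^esub> X)"

definition enveloping :: "'g::ab_group_add lie_super \<Rightarrow> 'g env superalg" where
  "enveloping L = \<lparr>carrier = carrier (env_ring L), mult = mult (env_ring L),
     one = one (env_ring L), zero = zero (env_ring L), add = add (env_ring L),
     smult = env_smult L, apart = (\<lambda>p. {X. env_homogeneous L p X})\<rparr>"

section \<open>Finite W-superalgebras\<close>

definition ad_nilpotent :: "'g::ab_group_add lie_super \<Rightarrow> 'g \<Rightarrow> bool" where
  "ad_nilpotent L x \<longleftrightarrow> (\<exists>k. \<forall>y. (lbr L x ^^ k) y = 0)"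

definition sl2_triple :: "'g::ab_group_add lie_super \<Rightarrow> 'g \<Rightarrow> 'g \<Rightarrow> 'g \<Rightarrow> bool" where
  "sl2_triple L e h f \<longleftrightarrow> e \<in> lpart L 0 \<and> h \<in> lpart L 0 \<and> f \<in> lpart L 0 \<and>
     lbr L h e = lscale L 2 e \<and> lbr L h f = lscale L (-2) f \<and> lbr L e f = h"

definition centralizer :: "'g::ab_group_add lie_super \<Rightarrow> 'g \<Rightarrow> 'g set" where
  "centralizer L e = {x. lbr L e x = 0}"

definition grade :: "'g::ab_group_add lie_super \<Rightarrow> 'g \<Rightarrow> int \<Rightarrow> 'g set" where
  "grade L h i = {x. lbr L h x = lscale L (of_int i) x}"

definition symplectic_basis ::
    "'g::ab_group_add lie_super \<Rightarrow> ('g \<Rightarrow> complex) \<Rightarrow> 'g \<Rightarrow> nat \<Rightarrow> (nat \<Rightarrow> 'g) \<Rightarrow> bool" where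
  "symplectic_basis L \<chi> h s u \<longleftrightarrow>
     inj_on u {1..2*s} \<and> \<not> module.dependent (lscale L) (u ` {1..2*s}) \<and>
     lspan L (u ` {1..2*s}) = grade L h (-1) \<inter> lpart L 0 \<and>
     (\<forall>i\<in>{1..2*s}. \<forall>j\<in>{1..2*s}. \<chi> (lbr L (u i) (u j)) =
        (if i + j = 2*s + 1 then (if i \<le> s then -1 else 1) else 0))"

definition symmetric_basis ::
    "'g::ab_group_add lie_super \<Rightarrow> ('g \<Rightarrow> complex) \<Rightarrow> 'g \<Rightarrow> nat \<Rightarrow> (nat \<Rightarrow> 'g) \<Rightarrow> bool" where
  "symmetric_basis L \<chi> h r v \<longleftrightarrow>
     inj_on v {1..r} \<and> \<not> module.dependent (lscale L) (v ` {1..r}) \<and>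
     lspan L (v ` {1..r}) = grade L h (-1) \<inter> lpart L 1 \<and>
     (\<forall>i\<in>{1..r}. \<forall>j\<in>{1..r}. \<chi> (lbr L (v i) (v j)) = (if i + j = r + 1 then 1 else 0))"

definition nil_m :: "'g::ab_group_add lie_super \<Rightarrow> 'g \<Rightarrow> nat \<Rightarrow> (nat \<Rightarrow> 'g) \<Rightarrow> nat \<Rightarrow> (nat \<Rightarrow> 'g) \<Rightarrow> 'g set"
  where
  "nil_m L h s u r v = lspan L ((\<Union>i\<in>{..-2}. grade L h i) \<union> u ` {s+1..2*s} \<union>
     v ` {j. (r + 1) div 2 < j \<and> j \<le> r})"

text \<open>To be used for odd \<open>r\<close> only, where \<open>(r + 1) div 2\<close> is the middle index.\<close>

definition nil_m' :: "'g::ab_group_add lie_super \<Rightarrow> 'g \<Rightarrow> nat \<Rightarrow> (nat \<Rightarrow> 'g) \<Rightarrow> nat \<Rightarrow> (nat \<Rightarrow> 'g) \<Rightarrow> 'g set"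
  where
  "nil_m' L h s u r v = lspan L (nil_m L h s u r v \<union> {v ((r + 1) div 2)})"

definition left_ideal :: "('a, 'b) ring_scheme \<Rightarrow> 'a set \<Rightarrow> bool" where
  "left_ideal R I \<longleftrightarrow> additive_subgroup I R \<and> (\<forall>a\<in>carrier R. \<forall>x\<in>I. a \<otimes>\<^bsub>R\<^esub> x \<in> I)"

definition gen_left_ideal :: "('a, 'b) ring_scheme \<Rightarrow> 'a set \<Rightarrow> 'a set" where
  "gen_left_ideal R S = \<Inter>{I. left_ideal R I \<and> S \<subseteq> I}"

definition I_chi :: "'g::ab_group_add lie_super \<Rightarrow> ('g \<Rightarrow> complex) \<Rightarrow> 'g set \<Rightarrow> 'g env set" where
  "I_chi L \<chi> m = gen_left_ideal (enveloping L)
     {env_embed L x \<ominus>\<^bsub>enveloping L\<^esub> (\<chi> x \<odot>\<^bsub>enveloping L\<^esub> \<one>\<^bsub>enveloping L\<^esub>) | x. x \<in> m}"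

definition supercommutator ::
    "'a superalg \<Rightarrow> bit \<Rightarrow> bit \<Rightarrow> 'a \<Rightarrow> 'a \<Rightarrow> 'a" where
  "supercommutator A p q x y = (x \<otimes>\<^bsub>A\<^esub> y) \<ominus>\<^bsub>A\<^esub> (koszul p q \<odot>\<^bsub>A\<^esub> (y \<otimes>\<^bsub>A\<^esub> x))"

text \<open>The coset of \<open>X\<close> in \<open>U(\<gg>)/I\<close> is annihilated by \<open>ad a\<close> for all homogeneous \<open>a \<in> n\<close>
  (\<open>n\<close> will be a graded subspace of \<open>\<gg>\<close>); \<open>X\<^sub>0\<close> and \<open>X\<^sub>1\<close> are the homogeneous
  components of \<open>X\<close>.\<close>

definition ad_invariant ::
    "'g::ab_group_add lie_super \<Rightarrow> 'g env set \<Rightarrow> 'g set \<Rightarrow> 'g env \<Rightarrow> bool" where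
  "ad_invariant L I n X \<longleftrightarrow> (\<exists>X\<^sub>0\<in>apart (enveloping L) 0. \<exists>X\<^sub>1\<in>apart (enveloping L) 1.
     X = X\<^sub>0 \<oplus>\<^bsub>enveloping L\<^esub> X\<^sub>1 \<and>
     (\<forall>p. \<forall>a\<in>n \<inter> lpart L p.
        supercommutator (enveloping L) p 0 (env_embed L a) X\<^sub>0 \<oplus>\<^bsub>enveloping L\<^esub>
        supercommutator (enveloping L) p 1 (env_embed L a) X\<^sub>1 \<in> I))"

text \<open>The superalgebra of \<open>ad n\<close>-invariants in \<open>U(\<gg>)/I\<close> with product
  \<open>(x + I)(y + I) = x y + I\<close>; \<^const>\<open>rcoset_mult\<close> is the union of the cosets \<open>x y + I\<close> over all
  representatives, and on invariants this is a single coset.\<close>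

definition invariants ::
    "'g::ab_group_add lie_super \<Rightarrow> 'g env set \<Rightarrow> 'g set \<Rightarrow> 'g env set superalg" where
  "invariants L I n =
     \<lparr>carrier = {I +>\<^bsub>enveloping L\<^esub> X | X. ad_invariant L I n X},
      mult = rcoset_mult (enveloping L) I,
      one = I +>\<^bsub>enveloping L\<^esub> \<one>\<^bsub>enveloping L\<^esub>,
      zero = I,
      add = set_add (enveloping L),
      smult = (\<lambda>c P. \<Union>X\<in>P. I +>\<^bsub>enveloping L\<^esub> (c \<odot>\<^bsub>enveloping L\<^esub> X)),
      apart = (\<lambda>p. {I +>\<^bsub>enveloping L\<^esub> X | X. X \<in> apart (enveloping L) p \<and> ad_invariant L I n X})\<rparr>"

definition finite_W ::
    "'g::ab_group_add lie_super \<Rightarrow> ('g \<Rightarrow> complex) \<Rightarrow> 'g \<Rightarrow> nat \<Rightarrow> (nat \<Rightarrow> 'g) \<Rightarrow> nat \<Rightarrow> (nat \<Rightarrow> 'g)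
      \<Rightarrow> 'g env set superalg" where
  "finite_W L \<chi> h s u r v =
     invariants L (I_chi L \<chi> (nil_m L h s u r v)) (nil_m L h s u r v)"

definition refined_W ::
    "'g::ab_group_add lie_super \<Rightarrow> ('g \<Rightarrow> complex) \<Rightarrow> 'g \<Rightarrow> nat \<Rightarrow> (nat \<Rightarrow> 'g) \<Rightarrow> nat \<Rightarrow> (nat \<Rightarrow> 'g)
      \<Rightarrow> 'g env set superalg" where
  "refined_W L \<chi> h s u r v =
     invariants L (I_chi L \<chi> (nil_m L h s u r v)) (nil_m' L h s u r v)"

end

theory Submission
  imports Defs
begin

text \<open>
  Everything comes from one odd element. Let \<open>v_mid\<close> be the middle vector of the basis
  \<open>v\<^sub>1, \<dots>, v\<^sub>r\<close> of \<open>\<gg>(-1)\<^sub>1\<close>, so that \<open>\<chi>([v_mid, v_mid]) = 1\<close>. Since \<open>[\<mm>, v_mid]\<close> lies in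
  \<open>\<mm> \<inter> ker \<chi>\<close>, its class \<open>\<Theta>\<close> in \<open>Q\<^sub>\<chi>\<close> is an odd element of \<open>U(\<gg>, e)\<close>, and
  \<open>2 v_mid\<^sup>2 = [v_mid, v_mid]\<close> gives \<open>\<Theta>\<^sup>2 = 1/2\<close>. On every \<open>U(\<gg>, e)\<close>-module \<open>\<Theta>\<close> therefore exchanges
  the two homogeneous parts bijectively. Hence no non-zero module has dimension below two, and a
  two-dimensional one is irreducible: a graded submodule containing a homogeneous
  vector \<open>z \<noteq> 0\<close> also contains \<open>\<Theta> z\<close>, which has the opposite parity.

  The algebra \<open>\<mm>'\<close> is \<open>\<mm>\<close> enlarged by \<open>v_mid\<close>, so invariance under \<open>ad \<mm>'\<close> adds precisely that
  elements of \<open>W'\<close> supercommute with \<open>\<Theta>\<close>. This makes the action of \<open>\<Theta>\<close> an odd automorphism of the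
  restriction to \<open>W'\<close>. If moreover some odd \<open>x \<in> W'\<close> acts by a non-zero operator \<open>S\<close>, then \<open>S\<close>
  anticommutes with \<open>\<Theta>\<close>, and on a space of dimension \<open>(1|1)\<close> this forces \<open>S\<^sup>2\<close> to be a non-zero scalar.
  So \<open>S\<close>, too, exchanges the homogeneous parts, the restriction is irreducible, even endomorphisms
  are scalars, and multiplying by \<open>\<Theta>\<close> turns odd endomorphisms into even ones; the
  endomorphism algebra is spanned by \<open>1\<close> and \<open>\<Theta>\<close>.

  Three points need an argument.

  \<^item> A middle vector exists, that is, \<open>r\<close> is odd (\<open>odd_r\<close>). The rank of the symmetric form
    \<open>(x, y) \<mapsto> \<chi>([x, y])\<close> on \<open>\<gg>\<^sub>1\<close> is \<open>d\<^sub>1\<close>. The operator \<open>D = ad h + 1\<close> is skew for this form and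
    \<open>ker D = \<gg>(-1)\<^sub>1\<close>. As the form is non-degenerate on \<open>ker D\<close>, the operator \<open>D\<close> is
    bijective on the orthogonal complement, and composing the form with \<open>D\<close> there gives an
    alternating form of the same rank. Alternating forms have even rank, so \<open>d\<^sub>1\<close> and \<open>r\<close> have
    the same parity (\<open>rank_parity_skew_operator\<close>).

  \<^item> The product of invariants is computed on representatives, because \<open>I\<^sub>\<chi> X \<subseteq> I\<^sub>\<chi>\<close> for
    invariant \<open>X\<close> (\<open>ad_invariant_right_stable\<close>).

  \<^item> An invariant comes with some decomposition into homogeneous components. It is the expected one
    only because \<open>U(\<gg>)\<^sub>0 \<inter> U(\<gg>)\<^sub>1 = 0\<close>, which follows from the parity automorphism of \<open>U(\<gg>)\<close>
    (\<open>homogeneous_both_zero\<close>).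
\<close>

section \<open>Parity of the rank of a bilinear form\<close>

lemmas lin_add = module_hom.add[OF Vector_Spaces.linear.axioms(3)]
lemmas lin_scale = module_hom.scale[OF Vector_Spaces.linear.axioms(3)]
lemmas lin_diff = module_hom.diff[OF Vector_Spaces.linear.axioms(3)]
lemmas lin_zero = module_hom.zero[OF Vector_Spaces.linear.axioms(3)]
lemmas lin_sum = module_hom.sum[OF Vector_Spaces.linear.axioms(3)]

lemma (in vector_space) span_insert_notin:
  assumes "subspace T" "independent (insert c C)" "c \<notin> C" "span (insert c C) \<inter> T = {0}"
  shows "c \<notin> span (C \<union> T)"
proof
  assume "c \<in> span (C \<union> T)"
  then obtain a t where a: "a \<in> span C" and t: "t \<in> T" and c: "c = a + t"
    using assms(1) by (auto simp: span_Un span_eq_iff[THEN iffD2])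
  have "c \<in> span (insert c C)" "a \<in> span (insert c C)"
    using a by (auto intro: span_base span_mono[THEN subsetD, of C])
  then have "t \<in> span (insert c C)"
    using span_diff[of c _ a] c by simp
  with t assms(4) have "t = 0" by blast
  with a c have "c \<in> span C" by simp
  with assms(2,3) show False by (simp add: independent_insert)
qed

lemma (in finite_dimensional_vector_space) dim_Un_independent:
  assumes "subspace T" "finite C" "independent C" "span C \<inter> T = {0}"
  shows "dim (C \<union> T) = card C + dim T"
  using assms(2-4)
proof (induction C rule: finite_induct)
  case (insert c C)
  have "span C \<subseteq> span (insert c C)" by (rule span_mono) auto
  moreover have "0 \<in> span C \<inter> T" using assms(1) by (simp add: subspace_0 span_zero)
  ultimately have "span C \<inter> T = {0}" using insert.prems by blast
  then have "dim (C \<union> T) = card C + dim T"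
    using insert.IH insert.prems(1) by (simp add: independent_insert insert.hyps split: if_splits)
  moreover have "c \<notin> span (C \<union> T)"
    using span_insert_notin[OF assms(1) insert.prems(1) insert.hyps(2)] insert.prems(2) by blast
  ultimately show ?case
    using insert.hyps by (simp add: dim_insert)
qed simp

text \<open>Induction on the dimension: a non-zero alternating form restricts to a hyperbolic plane
  \<open>span {a, b}\<close> with \<open>\<omega> a b = 1\<close>, which splits off orthogonally and leaves the radical unchanged.\<close>

lemma (in finite_dimensional_vector_space) even_rank_alternating:
  assumes "subspace N"
    and lin1: "\<And>y. Vector_Spaces.linear scale (*) (\<lambda>x. \<omega> x y)"
    and lin2: "\<And>x. Vector_Spaces.linear scale (*) (\<omega> x)"
    and alt: "\<And>x. x \<in> N \<Longrightarrow> \<omega> x x = 0"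
  shows "even (dim N + dim {x \<in> N. \<forall>y\<in>N. \<omega> x y = 0})"
  using assms(1) alt
proof (induction "dim N" arbitrary: N rule: less_induct)
  case less
  note [simp] = lin_add[OF lin1] lin_add[OF lin2] lin_scale[OF lin1] lin_scale[OF lin2]
    lin_diff[OF lin1] lin_diff[OF lin2] lin_zero[OF lin1] lin_zero[OF lin2]
  have skew: "\<omega> x y = - \<omega> y x" if "x \<in> N" "y \<in> N" for x y
    using less.prems(2)[OF subspace_add[OF less.prems(1) that]] less.prems(2) that
    by (simp add: eq_neg_iff_add_eq_0 add.commute)
  show ?case
  proof (cases "\<forall>x\<in>N. \<forall>y\<in>N. \<omega> x y = 0")
    case True
    then have "{x \<in> N. \<forall>y\<in>N. \<omega> x y = 0} = N" by auto
    then show ?thesis by simp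
  next
    case False
    then obtain a b' where a: "a \<in> N" and b': "b' \<in> N" "\<omega> a b' \<noteq> 0" by auto
    define b where "b = scale (1 / \<omega> a b') b'"
    have b: "b \<in> N" and ab: "\<omega> a b = 1"
      using b' subspace_scale[OF less.prems(1)] by (auto simp: b_def)
    have ba: "\<omega> b a = - 1" using skew[OF b a] ab by simp
    have aa: "\<omega> a a = 0" "\<omega> b b = 0" using less.prems(2) a b by auto
    define T where "T = {x \<in> N. \<omega> x a = 0 \<and> \<omega> x b = 0}"
    have T: "subspace T"
      using less.prems(1) by (auto simp: T_def subspace_def)
    have ne: "a \<noteq> b" using ab aa by auto
    have comb: "x = 0" if x: "x \<in> span {a, b}" "x \<in> T" for x
    proof -
      obtain k where "x - scale k a \<in> span {b}" using x(1) span_breakdown_eq[of x a "{b}"] by blast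
      then obtain l where "x - scale k a = scale l b" by (auto simp: span_singleton)
      then have "x = scale k a + scale l b" by (simp add: diff_eq_eq add.commute)
      with x(2) ab ba aa show ?thesis by (simp add: T_def)
    qed
    have b0: "b \<noteq> 0" using ab by auto
    have "a \<notin> span {b}"
      using ab aa by (auto simp: span_singleton)
    then have ind: "independent {a, b}"
      using b0 ne by (simp add: independent_insert dependent_single)
    have "N \<subseteq> span ({a, b} \<union> T)"
    proof
      fix x assume x: "x \<in> N"
      have "x - scale (\<omega> x b) a + scale (\<omega> x a) b \<in> T"
        using x a b less.prems(1) ab ba aa
        by (simp add: T_def subspace_add subspace_diff subspace_scale)
      then have "x - scale (\<omega> x b) a + scale (\<omega> x a) b \<in> span ({a, b} \<union> T)"
        by (simp add: span_base)
      moreover have "scale (\<omega> x b) a - scale (\<omega> x a) b \<in> span ({a, b} \<union> T)"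
        by (intro span_diff span_scale span_base) auto
      ultimately have "(x - scale (\<omega> x b) a + scale (\<omega> x a) b) +
          (scale (\<omega> x b) a - scale (\<omega> x a) b) \<in> span ({a, b} \<union> T)"
        by (rule span_add)
      then show "x \<in> span ({a, b} \<union> T)" by simp
    qed
    moreover have "{a, b} \<union> T \<subseteq> N" using a b by (auto simp: T_def)
    ultimately have "dim N = dim ({a, b} \<union> T)"
      by (intro order_antisym dim_mono dim_subset)
    also have "\<dots> = card {a, b} + dim T"
      using ind comb T by (intro dim_Un_independent) (auto simp: span_zero subspace_0)
    finally have dimN: "dim N = dim T + 2" using ne by simp
    have "{x \<in> N. \<forall>y\<in>N. \<omega> x y = 0} = {x \<in> T. \<forall>y\<in>T. \<omega> x y = 0}"
    proof (intro equalityI subsetI)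
      fix x assume "x \<in> {x \<in> T. \<forall>y\<in>T. \<omega> x y = 0}"
      then have x: "x \<in> T" "\<And>y. y \<in> T \<Longrightarrow> \<omega> x y = 0" by auto
      have "\<omega> x y = 0" if y: "y \<in> N" for y
      proof -
        have "y - scale (\<omega> y b) a + scale (\<omega> y a) b \<in> T"
          using y a b less.prems(1) ab ba aa
          by (simp add: T_def subspace_add subspace_diff subspace_scale)
        from x(2)[OF this] show ?thesis using x(1) by (simp add: T_def)
      qed
      with x show "x \<in> {x \<in> N. \<forall>y\<in>N. \<omega> x y = 0}" by (auto simp: T_def)
    qed (use a b in \<open>auto simp: T_def\<close>)
    moreover have "even (dim T + dim {x \<in> T. \<forall>y\<in>T. \<omega> x y = 0})"
      using less.hyps[of T] T less.prems(2) dimN by (auto simp: T_def)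
    ultimately show ?thesis using dimN by simp
  qed
qed

text \<open>The rank of \<open>\<omega>\<close> on \<open>N\<close> has the parity of \<open>dim (ker D)\<close>. The vectors \<open>\<sigma> c\<close> are a dual basis of
  \<open>ker D = span C\<close>, so \<open>N\<close> is the orthogonal sum of \<open>span C\<close> and its complement \<open>T\<close>. Skewness makes
  \<open>T\<close> stable under \<open>D\<close>, which is injective and hence bijective on \<open>T\<close>. So \<open>(x, y) \<mapsto> \<omega> (D x) y\<close> is
  an alternating form on \<open>T\<close> with the same radical as \<open>\<omega>\<close>.\<close>

lemma (in finite_dimensional_vector_space) rank_parity_skew_operator:
  assumes two: "(2 :: 'a) \<noteq> 0"
    and N: "subspace N"
    and lin1: "\<And>y. Vector_Spaces.linear scale (*) (\<lambda>x. \<omega> x y)"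
    and lin2: "\<And>x. Vector_Spaces.linear scale (*) (\<omega> x)"
    and sym: "\<And>x y. x \<in> N \<Longrightarrow> y \<in> N \<Longrightarrow> \<omega> x y = \<omega> y x"
    and D: "Vector_Spaces.linear scale scale D" "\<And>x. x \<in> N \<Longrightarrow> D x \<in> N"
    and skew: "\<And>x y. x \<in> N \<Longrightarrow> y \<in> N \<Longrightarrow> \<omega> (D x) y = - \<omega> x (D y)"
    and C: "finite C" "independent C" "span C = {x \<in> N. D x = 0}"
    and dual: "\<And>c. c \<in> C \<Longrightarrow> \<sigma> c \<in> span C"
      "\<And>c d. c \<in> C \<Longrightarrow> d \<in> C \<Longrightarrow> \<omega> (\<sigma> c) d = (if c = d then 1 else 0)"
  shows "even (dim N + card C + dim {x \<in> N. \<forall>y\<in>N. \<omega> x y = 0})"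
proof -
  note [simp] = lin_add[OF lin1] lin_add[OF lin2] lin_scale[OF lin1] lin_scale[OF lin2]
    lin_diff[OF lin1] lin_diff[OF lin2] lin_zero[OF lin1] lin_zero[OF lin2]
    lin_sum[OF lin1] lin_sum[OF lin2]
  define T where "T = {x \<in> N. \<forall>k\<in>span C. \<omega> x k = 0}"
  have T: "subspace T" using N by (auto simp: T_def subspace_def)
  have TI: "x \<in> T" if "x \<in> N" "\<And>c. c \<in> C \<Longrightarrow> \<omega> x c = 0" for x
  proof -
    have "\<omega> x k = 0" if "k \<in> span C" for k
      using that by (induction rule: span_induct_alt) (auto simp: that \<open>\<And>c. c \<in> C \<Longrightarrow> \<omega> x c = 0\<close>)
    with that show ?thesis by (auto simp: T_def)
  qed
  have CN: "x \<in> N" "D x = 0" if "x \<in> span C" for x using C(3) that by auto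
  have KT: "x = 0" if x: "x \<in> span C" "x \<in> T" for x
  proof -
    obtain a where a: "x = (\<Sum>c\<in>C. scale (a c) c)" using x(1) C(1) span_finite by auto
    have "a d = 0" if d: "d \<in> C" for d
    proof -
      have "0 = \<omega> (\<sigma> d) x"
        using x dual(1)[OF d] sym[of "\<sigma> d" x] CN by (auto simp: T_def)
      also have "\<dots> = (\<Sum>c\<in>C. if c = d then a c else 0)"
        using dual(2) d by (auto simp: a intro!: sum.cong)
      also have "\<dots> = a d" using C(1) d by simp
      finally show ?thesis by simp
    qed
    then show ?thesis by (simp add: a)
  qed
  \<comment> \<open>The orthogonal projection onto \<open>span C\<close>, expressed by the dual basis.\<close>
  define p where "p x = (\<Sum>d\<in>C. scale (\<omega> x d) (\<sigma> d))" for x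
  have p: "p x \<in> span C" for x unfolding p_def by (intro span_sum span_scale dual)
  have pT: "x - p x \<in> T" if "x \<in> N" for x
  proof (rule TI)
    show "x - p x \<in> N" using that p CN N by (auto intro: subspace_diff)
    fix c assume c: "c \<in> C"
    have "\<omega> (p x) c = (\<Sum>d\<in>C. if d = c then \<omega> x d else 0)"
      using dual(2) c by (auto simp: p_def intro!: sum.cong)
    also have "\<dots> = \<omega> x c" using C(1) c by simp
    finally show "\<omega> (x - p x) c = 0" by simp
  qed
  have "N \<subseteq> span (C \<union> T)"
  proof
    fix x assume "x \<in> N"
    then have "x - p x \<in> span (C \<union> T)" "p x \<in> span (C \<union> T)"
      using pT p span_mono[of C "C \<union> T"] by (auto intro: span_base)
    then have "(x - p x) + p x \<in> span (C \<union> T)" by (rule span_add)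
    then show "x \<in> span (C \<union> T)" by simp
  qed
  moreover have "C \<union> T \<subseteq> N" using CN span_base[of _ C] by (auto simp: T_def)
  ultimately have "dim N = dim (C \<union> T)" by (intro order_antisym dim_mono dim_subset)
  also have "\<dots> = card C + dim T"
    using KT T C by (intro dim_Un_independent) (auto simp: span_zero subspace_0)
  finally have dimN: "dim N = card C + dim T" .
  have DT: "D x \<in> T" if "x \<in> T" for x
    using that D(2) skew CN by (auto simp: T_def lin_zero[OF lin2])
  interpret finite_dimensional_vector_space_pair scale Basis scale Basis by unfold_locales
  have inj: "inj_on D (span T)"
    using KT C(3) D(1) T by (subst linear_inj_on_iff_eq_0) (auto simp: T_def span_eq_iff[THEN iffD2])
  have "D ` T = T"
    using dim_image_eq[OF D(1) inj] T DT module_hom.subspace_image[OF Vector_Spaces.linear.axioms(3)[OF D(1)] T]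
    by (intro subspace_dim_equal) auto
  have "{x \<in> N. \<forall>y\<in>N. \<omega> x y = 0} = {x \<in> T. \<forall>y\<in>T. \<omega> (D x) y = 0}"
  proof (intro equalityI subsetI)
    fix x assume "x \<in> {x \<in> T. \<forall>y\<in>T. \<omega> (D x) y = 0}"
    then have x: "x \<in> T" "\<And>y. y \<in> T \<Longrightarrow> \<omega> x (D y) = 0" using skew by (auto simp: T_def)
    then have x0: "\<omega> x y = 0" if "y \<in> T" for y using that \<open>D ` T = T\<close> by (metis (no_types) image_iff)
    have "\<omega> x y = 0" if "y \<in> N" for y
    proof -
      have "\<omega> x y = \<omega> x (y - p y) + \<omega> x (p y)" by simp
      also have "\<dots> = 0" using x0[OF pT[OF that]] p x(1) by (auto simp: T_def)
      finally show ?thesis .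
    qed
    with x show "x \<in> {x \<in> N. \<forall>y\<in>N. \<omega> x y = 0}" by (auto simp: T_def)
  qed (use CN D(2) skew in \<open>auto simp: T_def\<close>)
  moreover have "even (dim T + dim {x \<in> T. \<forall>y\<in>T. \<omega> (D x) y = 0})"
  proof (rule even_rank_alternating[OF T])
    show "Vector_Spaces.linear scale (*) (\<lambda>x. \<omega> (D x) y)" for y
      using Vector_Spaces.linear_compose[OF D(1) lin1] by (simp add: o_def)
    show "\<omega> (D x) x = 0" if "x \<in> T" for x
    proof -
      have "\<omega> (D x) x = - \<omega> (D x) x"
        using skew[of x x] sym[of x "D x"] D(2) that by (auto simp: T_def)
      then have "2 * \<omega> (D x) x = 0" unfolding mult_2 by (rule eq_neg_iff_add_eq_0[THEN iffD1])
      then show ?thesis using two by simp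
    qed
  qed (rule lin2)
  ultimately show ?thesis using dimN by auto
qed

section \<open>Gradings of Lie superalgebras and the middle vector\<close>

locale super_lie =
  fixes L :: "'g::ab_group_add lie_super"
  assumes lie: "lie_superalgebra L"
begin

sublocale super_space "lscale L" "lpart L"
  using lie by (simp add: lie_superalgebra_def)

lemma br_linear_right: "Vector_Spaces.linear (lscale L) (lscale L) (lbr L x)"
  and br_linear_left: "Vector_Spaces.linear (lscale L) (lscale L) (\<lambda>x. lbr L x y)"
  using lie by (simp_all add: lie_superalgebra_def)

lemmas br_simps [simp] =
  lin_add[OF br_linear_right] lin_add[OF br_linear_left]
  lin_scale[OF br_linear_right] lin_scale[OF br_linear_left]
  lin_diff[OF br_linear_right] lin_diff[OF br_linear_left]
  lin_zero[OF br_linear_right] lin_zero[OF br_linear_left]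

lemma br_part: "x \<in> lpart L p \<Longrightarrow> y \<in> lpart L q \<Longrightarrow> lbr L x y \<in> lpart L (p + q)"
  and br_commute:
    "x \<in> lpart L p \<Longrightarrow> y \<in> lpart L q \<Longrightarrow> lbr L x y = lscale L (- koszul p q) (lbr L y x)"
  and br_jacobi:
    "x \<in> lpart L p \<Longrightarrow> y \<in> lpart L q \<Longrightarrow>
      lbr L x (lbr L y z) = lbr L (lbr L x y) z + lscale L (koszul p q) (lbr L y (lbr L x z))"
  using lie unfolding lie_superalgebra_def by (elim conjE, metis)+

lemma part_decompE:
  obtains a b where "a \<in> lpart L 0" "b \<in> lpart L 1" "x = a + b"
  using part_decomp by blast

text \<open>With an even argument all Koszul signs are trivial, so the homogeneous identities extend
  bilinearly to arbitrary elements.\<close>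

lemma even_br_commute:
  assumes "z \<in> lpart L 0"
  shows "lbr L z x = - lbr L x z"
proof -
  obtain a b where x: "a \<in> lpart L 0" "b \<in> lpart L 1" "x = a + b" by (rule part_decompE)
  then show ?thesis
    using br_commute[OF assms x(1)] br_commute[OF assms x(2)] by (simp add: koszul_def)
qed

lemma even_br_derivation:
  assumes "z \<in> lpart L 0"
  shows "lbr L z (lbr L x y) = lbr L (lbr L z x) y + lbr L x (lbr L z y)"
proof -
  obtain a b where x: "a \<in> lpart L 0" "b \<in> lpart L 1" "x = a + b" by (rule part_decompE)
  then show ?thesis
    using br_jacobi[OF assms x(1)] br_jacobi[OF assms x(2)] by (simp add: koszul_def)
qed

lemma br_grade:
  assumes "h \<in> lpart L 0" "x \<in> grade L h i" "y \<in> grade L h j"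
  shows "lbr L x y \<in> grade L h (i + j)"
  using assms(2,3) by (simp add: grade_def even_br_derivation[OF assms(1)] scale_left_distrib)

lemma part_unique:
  assumes "a \<in> lpart L 0" "b \<in> lpart L 1" "a + b = 0"
  shows "a = 0" "b = 0"
proof -
  have "a = - b" using assms(3) by (simp add: eq_neg_iff_add_eq_0)
  then have "a \<in> lpart L 1" using assms(2) subspace_neg[OF subspace_part] by simp
  with assms(1) part_disjoint show "a = 0" by blast
  with assms(3) show "b = 0" by simp
qed

lemma grade_graded:
  assumes "h \<in> lpart L 0" "a \<in> lpart L 0" "b \<in> lpart L 1" "a + b \<in> grade L h i"
  shows "a \<in> grade L h i" "b \<in> grade L h i"
proof -
  let ?a = "lbr L h a - lscale L (of_int i) a" and ?b = "lbr L h b - lscale L (of_int i) b"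
  have "?a \<in> lpart L 0" "?b \<in> lpart L 1"
    using br_part[OF assms(1,2)] br_part[OF assms(1,3)] assms(2,3)
    by (auto intro: subspace_diff subspace_scale subspace_part)
  moreover have eq: "?a + ?b = lbr L h (a + b) - lscale L (of_int i) (a + b)"
    by (simp add: scale_right_distrib)
  have "?a + ?b = 0" unfolding eq using assms(4) by (simp add: grade_def del: br_simps)
  ultimately have "?a = 0" "?b = 0" by (rule part_unique)+
  then show "a \<in> grade L h i" "b \<in> grade L h i" by (simp_all add: grade_def)
qed

end

text \<open>The part of the data of the theorem that concerns \<open>\<gg>\<close> and \<open>e\<close> but no module.\<close>

locale odd_whittaker = super_lie L
  for L :: "'g::ab_group_add lie_super" +
  fixes B :: "'g \<Rightarrow> 'g \<Rightarrow> complex"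
    and e h f :: 'g
    and u v :: "nat \<Rightarrow> 'g"
    and s r :: nat
  assumes finite_dim: "finite_dimensional L"
    and form: "invariant_form L B"
    and triple: "sl2_triple L e h f"
    and odd_defect: "odd (int (ldim L (lpart L 1)) - int (ldim L (centralizer L e \<inter> lpart L 1)))"
    and u_basis: "symplectic_basis L (B e) h s u"
    and v_basis: "symmetric_basis L (B e) h r v"
begin

lemma form_linear_right: "Vector_Spaces.linear (lscale L) (*) (B x)"
  and form_linear_left: "Vector_Spaces.linear (lscale L) (*) (\<lambda>x. B x y)"
  using form by (simp_all add: invariant_form_def)

lemmas form_simps [simp] =
  lin_add[OF form_linear_right] lin_add[OF form_linear_left]
  lin_scale[OF form_linear_right] lin_scale[OF form_linear_left]
  lin_diff[OF form_linear_right] lin_diff[OF form_linear_left]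
  lin_zero[OF form_linear_right] lin_zero[OF form_linear_left]
  module_hom.neg[OF Vector_Spaces.linear.axioms(3)[OF form_linear_right]]
  module_hom.neg[OF Vector_Spaces.linear.axioms(3)[OF form_linear_left]]

lemma form_invariant: "B (lbr L x y) z = B x (lbr L y z)"
  using form unfolding invariant_form_def by blast

lemma form_parity: "x \<in> lpart L p \<Longrightarrow> y \<in> lpart L q \<Longrightarrow> p \<noteq> q \<Longrightarrow> B x y = 0"
  using form unfolding invariant_form_def by blast

lemma form_nondegenerate: "(\<And>y. B x y = 0) \<Longrightarrow> x = 0"
  using form unfolding invariant_form_def by blast

lemma e_even: "e \<in> lpart L 0" and h_even: "h \<in> lpart L 0"
  and he: "lbr L h e = lscale L 2 e"
  using triple by (simp_all add: sl2_triple_def)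

lemma chi_odd: "x \<in> lpart L 1 \<Longrightarrow> B e x = 0"
  using form_parity[OF e_even] by simp

lemma form_h_skew: "B (lbr L h x) y = - B x (lbr L h y)"
  by (simp add: even_br_commute[OF h_even, of x] form_invariant)

text \<open>By invariance \<open>ad h\<close> is skew for the form, and \<open>e\<close> has degree 2, so \<open>e\<close> pairs only with degree -2.\<close>

lemma chi_grade:
  assumes "x \<in> grade L h j" "j \<noteq> - 2"
  shows "B e x = 0"
proof -
  have "2 * B e x = - (of_int j * B e x)"
    using form_h_skew[of e x] assms(1) by (simp add: he grade_def)
  then have "of_int (2 + j) * B e x = 0" by (simp add: algebra_simps)
  moreover have "(of_int (2 + j) :: complex) \<noteq> 0"
    using assms(2) by (simp only: of_int_eq_0_iff)
  ultimately show ?thesis by (metis mult_eq_0_iff)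
qed

lemma u_span: "span (u ` {1..2 * s}) = grade L h (-1) \<inter> lpart L 0"
  using u_basis unfolding symplectic_basis_def by (elim conjE)

lemma v_span: "span (v ` {1..r}) = grade L h (-1) \<inter> lpart L 1"
  and v_inj: "inj_on v {1..r}"
  and v_independent: "independent (v ` {1..r})"
  using v_basis unfolding symmetric_basis_def by blast+

lemma v_gram:
  assumes "i \<in> {1..r}" "j \<in> {1..r}"
  shows "B e (lbr L (v i) (v j)) = (if i + j = r + 1 then 1 else 0)"
  using v_basis assms unfolding symmetric_basis_def by (elim conjE) (drule (1) bspec)+

lemma u_in: "i \<in> {1..2 * s} \<Longrightarrow> u i \<in> grade L h (-1) \<inter> lpart L 0"
  unfolding u_span[symmetric] by (intro span_base imageI)

lemma v_in: "i \<in> {1..r} \<Longrightarrow> v i \<in> grade L h (-1) \<inter> lpart L 1"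
  unfolding v_span[symmetric] by (intro span_base imageI)

text \<open>The form \<open>\<chi>([x, y])\<close> equals \<open>B [e, x] y\<close>, so its radical on \<open>\<gg>\<^sub>1\<close> is \<open>\<gg>\<^sup>e\<^sub>1\<close> and its rank is the
  odd number \<open>d\<^sub>1\<close>. It is symmetric because the bracket of odd elements is.\<close>

lemma odd_r: "odd r"
proof -
  obtain S where S: "finite S" "span S = UNIV"
    using finite_dim by (auto simp: finite_dimensional_def)
  obtain Basis where Basis: "Basis \<subseteq> S" "independent Basis" "S \<subseteq> span Basis"
    by (rule maximal_independent_subset)
  interpret fd: finite_dimensional_vector_space "lscale L" Basis
    using S Basis finite_subset[of Basis S] span_mono[of S "span Basis"]
    by unfold_locales (auto simp: span_span)
  define D where "D x = lbr L h x + x" for x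
  define \<sigma> where "\<sigma> c = v (r + 1 - inv_into {1..r} v c)" for c
  have "even (dim (lpart L 1) + card (v ` {1..r}) +
      dim {x \<in> lpart L 1. \<forall>y\<in>lpart L 1. B e (lbr L x y) = 0})"
  proof (rule fd.rank_parity_skew_operator[where D = D and \<sigma> = \<sigma>])
    show "Vector_Spaces.linear (lscale L) (*) (\<lambda>x. B e (lbr L x y))" for y
      using Vector_Spaces.linear_compose[OF br_linear_left form_linear_right] by (simp add: o_def)
    show "Vector_Spaces.linear (lscale L) (*) (\<lambda>y. B e (lbr L x y))" for x
      using Vector_Spaces.linear_compose[OF br_linear_right form_linear_right] by (simp add: o_def)
    show "B e (lbr L x y) = B e (lbr L y x)" if "x \<in> lpart L 1" "y \<in> lpart L 1" for x y
      using br_commute[OF that] by (simp add: koszul_def)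
    show "Vector_Spaces.linear (lscale L) (lscale L) D"
      unfolding D_def
      by (auto intro!: Vector_Spaces.linear.intro module_hom.intro module_hom_axioms.intro
          vector_space_axioms module_axioms simp: scale_right_distrib)
    show "D x \<in> lpart L 1" if "x \<in> lpart L 1" for x
      using br_part[OF h_even that] that subspace_add[OF subspace_part] by (simp add: D_def)
    show "B e (lbr L (D x) y) = - B e (lbr L x (D y))" if "x \<in> lpart L 1" "y \<in> lpart L 1" for x y
    proof -
      \<comment> \<open>\<open>e\<close> has degree 2; the summand 1 in each of the two copies of \<open>D\<close> compensates for this shift.\<close>
      have "B e (lbr L h (lbr L x y)) = - 2 * B e (lbr L x y)"
        using form_h_skew[of e "lbr L x y"] by (simp add: he)
      then show ?thesis by (simp add: D_def even_br_derivation[OF h_even] eq_neg_iff_add_eq_0 add_ac)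
    qed
    show "span (v ` {1..r}) = {x \<in> lpart L 1. D x = 0}"
      unfolding v_span by (auto simp: D_def grade_def eq_neg_iff_add_eq_0)
    fix c assume "c \<in> v ` {1..r}"
    then obtain i where i: "i \<in> {1..r}" "c = v i" by auto
    then have \<sigma>: "\<sigma> c = v (r + 1 - i)" "r + 1 - i \<in> {1..r}"
      using inv_into_f_f[OF v_inj] by (auto simp: \<sigma>_def)
    then show "\<sigma> c \<in> span (v ` {1..r})" by (auto intro: span_base)
    fix d assume "d \<in> v ` {1..r}"
    then obtain j where j: "j \<in> {1..r}" "d = v j" by auto
    show "B e (lbr L (\<sigma> c) d) = (if c = d then 1 else 0)"
    proof -
      have "c = d \<longleftrightarrow> i = j" using i j inj_onD[OF v_inj, of i j] by blast
      moreover have "r + 1 - i + j = r + 1 \<longleftrightarrow> i = j" using i(1) by auto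
      ultimately show ?thesis using v_gram[OF \<sigma>(2) j(1)] by (simp only: \<sigma>(1) j(2))
    qed
  qed (use v_independent in \<open>auto intro: subspace_part\<close>)
  moreover have "{x \<in> lpart L 1. \<forall>y\<in>lpart L 1. B e (lbr L x y) = 0} =
      centralizer L e \<inter> lpart L 1"
  proof (intro equalityI subsetI)
    fix x assume "x \<in> {x \<in> lpart L 1. \<forall>y\<in>lpart L 1. B e (lbr L x y) = 0}"
    then have x: "x \<in> lpart L 1" "\<And>y. y \<in> lpart L 1 \<Longrightarrow> B (lbr L e x) y = 0"
      by (auto simp: form_invariant)
    have "B (lbr L e x) y = 0" for y
    proof -
      obtain a b where "a \<in> lpart L 0" "b \<in> lpart L 1" "y = a + b" by (rule part_decompE)
      then show ?thesis
        using x(2) form_parity[of "lbr L e x" 1 a 0] br_part[OF e_even x(1)] by simp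
    qed
    then show "x \<in> centralizer L e \<inter> lpart L 1"
      using x form_nondegenerate by (auto simp: centralizer_def)
  qed (auto simp: centralizer_def simp flip: form_invariant)
  moreover have "card (v ` {1..r}) = r" using card_image[OF v_inj] by simp
  ultimately show ?thesis using odd_defect by (auto simp del: One_nat_def)
qed

abbreviation m where "m \<equiv> nil_m L h s u r v"
abbreviation m' where "m' \<equiv> nil_m' L h s u r v"

text \<open>Here \<open>(r + 1) div 2\<close> is the middle index because \<open>r\<close> is odd.\<close>

definition v_mid where "v_mid = v ((r + 1) div 2)"

lemma mid_in: "(r + 1) div 2 \<in> {1..r}" and mid_sum: "(r + 1) div 2 + (r + 1) div 2 = r + 1"
  using odd_r by (simp_all, presburger+)

lemma mid_grade: "v_mid \<in> grade L h (-1)" and mid_odd: "v_mid \<in> lpart L 1"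
  using v_in[OF mid_in] by (simp_all add: v_mid_def)

lemma chi_mid_square: "B e (lbr L v_mid v_mid) = 1"
  unfolding v_mid_def v_gram[OF mid_in mid_in] mid_sum by simp

lemma grade_subset_m: "i \<le> -2 \<Longrightarrow> grade L h i \<subseteq> m"
  by (auto simp: nil_m_def intro: span_base)

lemma mid_square_in_m: "lbr L v_mid v_mid \<in> m"
  using br_grade[OF h_even mid_grade mid_grade] grade_subset_m[of "-2"] by auto

lemma m_subset_m': "m \<subseteq> m'" and mid_in_m': "v_mid \<in> m'"
  by (auto simp: nil_m'_def v_mid_def intro: span_base)

lemma subspace_m: "subspace m" by (simp add: nil_m_def)

text \<open>\<open>[\<mm>, v_mid] \<subseteq> \<mm> \<inter> ker \<chi>\<close>. Brackets with degree at most -2 have degree at most -3, where \<open>\<chi>\<close>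
  vanishes. Brackets with the \<open>u\<^sub>i\<close> are odd. Among the \<open>v\<^sub>j\<close> only \<open>v_mid\<close> itself pairs with \<open>v_mid\<close>,
  and it does not lie in \<open>\<mm>\<close>.\<close>

lemma ad_mid_m:
  assumes "a \<in> m"
  shows "lbr L a v_mid \<in> m \<and> B e (lbr L a v_mid) = 0"
proof -
  let ?T = "{a. lbr L a v_mid \<in> m \<and> B e (lbr L a v_mid) = 0}"
  have "a \<in> ?T"
    if "a \<in> (\<Union>i\<in>{..-2}. grade L h i) \<union> u ` {s+1..2*s} \<union>
      v ` {j. (r + 1) div 2 < j \<and> j \<le> r}" for a
  proof -
    from that consider i where "i \<le> -2" "a \<in> grade L h i"
      | i where "i \<in> {s+1..2*s}" "a = u i"
      | j where "(r + 1) div 2 < j" "j \<le> r" "a = v j"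
      by blast
    then show ?thesis
    proof cases
      case 1
      then have aw: "lbr L a v_mid \<in> grade L h (i - 1)" using br_grade[OF h_even _ mid_grade, of a i] by simp
      from 1 have "B e (lbr L a v_mid) = 0" by (intro chi_grade[OF aw]) simp
      with 1 show ?thesis using subsetD[OF grade_subset_m aw] by simp
    next
      case 2
      then have "lbr L a v_mid \<in> grade L h (-2)" "lbr L a v_mid \<in> lpart L 1"
        using br_grade[OF h_even _ mid_grade, of a "-1"] br_part[OF _ mid_odd, of a 0] u_in by auto
      then show ?thesis using chi_odd grade_subset_m[of "-2"] by auto
    next
      case 3
      then have "lbr L a v_mid \<in> grade L h (-2)"
        using br_grade[OF h_even _ mid_grade, of a "-1"] v_in by auto
      moreover have "B e (lbr L a v_mid) = 0"
      proof -
        have "j \<in> {1..r}" "j + (r + 1) div 2 \<noteq> r + 1" using 3 mid_in mid_sum by auto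
        then show ?thesis unfolding 3 v_mid_def by (simp only: v_gram[OF _ mid_in] if_False)
      qed
      ultimately show ?thesis using grade_subset_m[of "-2"] by auto
    qed
  qed
  moreover have "subspace ?T"
    unfolding subspace_def[of ?T]
    by (auto intro: subspace_add[OF subspace_m] subspace_scale[OF subspace_m] subspace_0[OF subspace_m])
  ultimately have "m \<subseteq> ?T" unfolding nil_m_def by (intro span_minimal) blast+
  with assms show ?thesis by blast
qed

text \<open>Invariance speaks of homogeneous elements only; this lemma carries it over to all of \<open>\<mm>\<close>.\<close>

lemma m_graded:
  assumes "a \<in> m"
  shows "\<exists>a0\<in>m \<inter> lpart L 0. \<exists>a1\<in>m \<inter> lpart L 1. a = a0 + a1"
proof -
  have 0: "0 \<in> m \<inter> lpart L p" for p
    using subspace_m subspace_part by (auto simp: subspace_0)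
  let ?T = "{x + y |x y. x \<in> m \<inter> lpart L 0 \<and> y \<in> m \<inter> lpart L 1}"
  have "a \<in> ?T"
    if "a \<in> (\<Union>i\<in>{..-2}. grade L h i) \<union> u ` {s+1..2*s} \<union>
      v ` {j. (r + 1) div 2 < j \<and> j \<le> r}" for a
  proof -
    have "a \<in> m" using that unfolding nil_m_def by (rule span_base)
    from that consider i where "i \<le> -2" "a \<in> grade L h i"
      | i where "i \<in> {s+1..2*s}" "a = u i"
      | j where "(r + 1) div 2 < j" "j \<le> r" "a = v j"
      by blast
    then have "\<exists>x y. a = x + y \<and> x \<in> m \<inter> lpart L 0 \<and> y \<in> m \<inter> lpart L 1"
    proof cases
      case 1
      obtain x y where "x \<in> lpart L 0" "y \<in> lpart L 1" "a = x + y" by (rule part_decompE)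
      then show ?thesis using grade_graded[OF h_even] 1 grade_subset_m by blast
    next
      case 2
      then show ?thesis using u_in \<open>a \<in> m\<close> 0 by (intro exI[of _ a] exI[of _ 0]) auto
    next
      case 3
      then show ?thesis using v_in \<open>a \<in> m\<close> 0 by (intro exI[of _ 0] exI[of _ a]) auto
    qed
    then show ?thesis by simp
  qed
  moreover have "subspace ?T"
    by (intro subspace_sums subspace_inter subspace_m subspace_part)
  ultimately have "m \<subseteq> ?T" unfolding nil_m_def by (intro span_minimal) blast+
  with assms show ?thesis by blast
qed

end

section \<open>The enveloping superalgebra and its parity automorphism\<close>

lemma ring_free_ring: "ring (free_ring :: 'g free_alg ring)"
proof (intro ringI abelian_groupI)
  show "\<exists>y\<in>carrier free_ring. y \<oplus>\<^bsub>free_ring\<^esub> x = \<zero>\<^bsub>free_ring\<^esub>" for x :: "'g free_alg"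
    by (intro bexI[of _ "- x"]) (simp_all add: free_ring_def)
  show "Group.monoid (free_ring :: 'g free_alg ring)"
    by (rule monoidI) (simp_all add: free_ring_def mult.assoc)
qed (simp_all add: free_ring_def algebra_simps)

lemma ideal_env_ideal: "ideal (env_ideal L) free_ring"
  unfolding env_ideal_def
  by (rule ring.genideal_ideal[OF ring_free_ring]) (simp add: free_ring_def)

lemma free_ring_uminus: "\<ominus>\<^bsub>free_ring\<^esub> x = - x"
  by (rule abelian_group.minus_equality[OF ring.is_abelian_group[OF ring_free_ring]])
    (simp_all add: free_ring_def)

lemma env_ideal_0 [simp]: "0 \<in> env_ideal L"
  and env_ideal_add: "s \<in> env_ideal L \<Longrightarrow> t \<in> env_ideal L \<Longrightarrow> s + t \<in> env_ideal L"
  and env_ideal_uminus: "s \<in> env_ideal L \<Longrightarrow> - s \<in> env_ideal L"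
  and env_ideal_lmult: "s \<in> env_ideal L \<Longrightarrow> t * s \<in> env_ideal L"
  and env_ideal_rmult: "s \<in> env_ideal L \<Longrightarrow> s * t \<in> env_ideal L"
proof -
  interpret ideal "env_ideal L" free_ring by (rule ideal_env_ideal)
  show "0 \<in> env_ideal L" using additive_subgroup.zero_closed[OF additive_subgroup_axioms] by (simp add: free_ring_def)
  show "s \<in> env_ideal L \<Longrightarrow> t \<in> env_ideal L \<Longrightarrow> s + t \<in> env_ideal L"
    using additive_subgroup.a_closed[OF additive_subgroup_axioms, of s t] by (simp add: free_ring_def)
  show "s \<in> env_ideal L \<Longrightarrow> - s \<in> env_ideal L"
    using additive_subgroup.a_inv_closed[OF additive_subgroup_axioms, of s] by (simp add: free_ring_uminus)
  show "s \<in> env_ideal L \<Longrightarrow> t * s \<in> env_ideal L"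
    using I_l_closed[of s t] by (simp add: free_ring_def)
  show "s \<in> env_ideal L \<Longrightarrow> s * t \<in> env_ideal L"
    using I_r_closed[of s t] by (simp add: free_ring_def)
qed

lemma env_ideal_diff: "s \<in> env_ideal L \<Longrightarrow> t \<in> env_ideal L \<Longrightarrow> s - t \<in> env_ideal L"
  using env_ideal_add[of s L "- t"] env_ideal_uminus[of t L] by simp

lemma env_relations_subset: "env_relations L \<subseteq> env_ideal L"
  unfolding env_ideal_def
  by (rule ring.genideal_self[OF ring_free_ring]) (simp add: free_ring_def)

lemma env_ideal_gen_add: "gen (x + y) - (gen x + gen y) \<in> env_ideal L"
  and env_ideal_gen_scale: "gen (lscale L c x) - const c * gen x \<in> env_ideal L"
  and env_ideal_gen_br: "x \<in> lpart L p \<Longrightarrow> y \<in> lpart L q \<Longrightarrow>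
    gen x * gen y - const (koszul p q) * (gen y * gen x) - gen (lbr L x y) \<in> env_ideal L"
  using env_relations_subset[of L] unfolding env_relations_def by blast+

lemma const_mult: "const a * const b = const (a * b)"
  by (simp add: const_def mult_single)

lemma const_1 [simp]: "const 1 = 1"
  by (simp add: const_def)

lemma const_0 [simp]: "const 0 = 0"
  by (simp add: const_def)

lemma const_uminus: "const (- a) = - const a"
  by (simp add: const_def single_uminus)

lemma const_add: "const (a + b) = const a + const b"
  by (simp add: const_def single_add)

text \<open>Identities in the free algebra that are additive in each variable need to be checked on monomials only.\<close>

lemma poly_mapping_additive_induct [case_names zero single add]:
  assumes "P 0" "\<And>k c. P (Poly_Mapping.single k c)" "\<And>s t. P s \<Longrightarrow> P t \<Longrightarrow> P (s + t)"
  shows "P (t :: 'a \<Rightarrow>\<^sub>0 'b::comm_monoid_add)"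
proof -
  have "P (\<Sum>k\<in>K. Poly_Mapping.single k (Poly_Mapping.lookup t k))" if "finite K" for K
    using that by (induction rule: finite_induct) (auto intro: assms)
  moreover have "t = (\<Sum>k\<in>Poly_Mapping.keys t. Poly_Mapping.single k (Poly_Mapping.lookup t k))"
    by (rule poly_mapping_eqI)
      (simp add: lookup_sum lookup_single when_def sum.delta' in_keys_iff if_distrib)
  ultimately show ?thesis by (metis finite_keys)
qed

lemma const_central: "const c * t = t * const c"
  by (induction t rule: poly_mapping_additive_induct)
    (simp_all add: const_def mult_single algebra_simps)

text \<open>The next lemmas express the structure of \<open>U(\<gg>)\<close> by representatives, so that computations take
  place in the free algebra, which is a ring in the sense of type classes.\<close>

lemma env_class_eq_iff: "env_class L s = env_class L t \<longleftrightarrow> s - t \<in> env_ideal L"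
proof -
  interpret ideal "env_ideal L" free_ring by (rule ideal_env_ideal)
  have "env_class L s = env_class L t \<longleftrightarrow> s \<ominus>\<^bsub>free_ring\<^esub> t \<in> env_ideal L"
    unfolding env_class_def
    by (rule quotient_eq_iff_same_a_r_cos[symmetric, OF ideal_axioms]) (simp_all add: free_ring_def)
  then show ?thesis by (simp add: a_minus_def free_ring_uminus) (simp add: free_ring_def)
qed

lemma carrier_enveloping: "carrier (enveloping L) = range (env_class L)"
  by (auto simp: enveloping_def env_ring_def FactRing_def A_RCOSETS_def' env_class_def free_ring_def)

lemma env_class_add: "env_class L s \<oplus>\<^bsub>enveloping L\<^esub> env_class L t = env_class L (s + t)"
proof -
  interpret ideal "env_ideal L" free_ring by (rule ideal_env_ideal)
  show ?thesis
    using a_rcos_sum[of s t]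
    by (simp add: enveloping_def env_ring_def FactRing_def env_class_def)
      (simp add: free_ring_def)
qed

lemma env_class_mult: "env_class L s \<otimes>\<^bsub>enveloping L\<^esub> env_class L t = env_class L (s * t)"
proof -
  interpret ideal "env_ideal L" free_ring by (rule ideal_env_ideal)
  show ?thesis
    using rcoset_mult_add[of s t]
    by (simp add: enveloping_def env_ring_def FactRing_def env_class_def)
      (simp add: free_ring_def)
qed

lemma env_class_one: "\<one>\<^bsub>enveloping L\<^esub> = env_class L 1"
  by (simp add: enveloping_def env_ring_def FactRing_def env_class_def) (simp add: free_ring_def)

lemma env_class_zero: "\<zero>\<^bsub>enveloping L\<^esub> = env_class L 0"
proof -
  interpret ideal "env_ideal L" free_ring by (rule ideal_env_ideal)
  show ?thesis
    using a_rcos_const[of 0] by (simp add: enveloping_def env_ring_def FactRing_def env_class_def)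
qed

lemma env_class_smult: "c \<odot>\<^bsub>enveloping L\<^esub> env_class L t = env_class L (const c * t)"
  using env_class_mult[of L "const c" t] by (simp add: enveloping_def env_smult_def)

lemma ring_enveloping: "ring (enveloping L)"
proof (intro ringI abelian_groupI)
  show "\<exists>y\<in>carrier (enveloping L). y \<oplus>\<^bsub>enveloping L\<^esub> x = \<zero>\<^bsub>enveloping L\<^esub>"
    if "x \<in> carrier (enveloping L)" for x
  proof -
    from that obtain t where "x = env_class L t" by (auto simp: carrier_enveloping)
    then show ?thesis
      by (intro bexI[of _ "env_class L (- t)"])
        (simp_all add: env_class_add env_class_zero carrier_enveloping)
  qed
  show "Group.monoid (enveloping L)"
    by (rule monoidI)
      (auto simp: carrier_enveloping env_class_mult env_class_one mult.assoc)
qed (auto simp: carrier_enveloping env_class_mult env_class_add env_class_zero algebra_simps)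

lemma env_class_uminus: "\<ominus>\<^bsub>enveloping L\<^esub> env_class L t = env_class L (- t)"
proof -
  interpret ring "enveloping L" by (rule ring_enveloping)
  show ?thesis
    by (rule minus_equality) (simp_all add: env_class_add env_class_zero carrier_enveloping)
qed

lemma env_class_minus:
  "env_class L s \<ominus>\<^bsub>enveloping L\<^esub> env_class L t = env_class L (s - t)"
  by (simp add: a_minus_def env_class_uminus env_class_add)

definition parity_sign :: "bit \<Rightarrow> complex" where
  "parity_sign p = (if p = 0 then 1 else -1)"

lemma parity_sign_add: "parity_sign (p + q) = parity_sign p * parity_sign q"
  by (cases "p = 0"; cases "q = 0") (simp_all add: parity_sign_def)

lemma bit_cases: "p = 0 \<or> p = (1 :: bit)"
  by (metis bit_not_one_iff)

definition (in super_space) parity_map :: "'a \<Rightarrow> 'a" where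
  "parity_map x = (THE y. \<exists>a\<in>part 0. \<exists>b\<in>part 1. x = a + b \<and> y = a - b)"

context super_lie
begin

abbreviation P where "P \<equiv> parity_map"

lemma parity_map_decomp:
  assumes "a \<in> lpart L 0" "b \<in> lpart L 1"
  shows "P (a + b) = a - b"
  unfolding parity_map_def
proof (rule the_equality)
  show "\<exists>a'\<in>lpart L 0. \<exists>b'\<in>lpart L 1. a + b = a' + b' \<and> a - b = a' - b'"
    using assms by blast
  fix y assume "\<exists>a'\<in>lpart L 0. \<exists>b'\<in>lpart L 1. a + b = a' + b' \<and> y = a' - b'"
  then obtain a' b' where *: "a' \<in> lpart L 0" "b' \<in> lpart L 1" "a + b = a' + b'" "y = a' - b'"
    by blast
  have "a - a' \<in> lpart L 0" "b - b' \<in> lpart L 1"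
    using assms * by (simp_all add: subspace_diff[OF subspace_part])
  moreover have "(a - a') + (b - b') = 0" using *(3) by (simp add: algebra_simps)
  ultimately have "a - a' = 0" "b - b' = 0" by (rule part_unique)+
  with * show "y = a - b" by simp
qed

lemma parity_map_part: "x \<in> lpart L p \<Longrightarrow> P x = lscale L (parity_sign p) x"
  using parity_map_decomp[of x 0] parity_map_decomp[of 0 x] bit_cases[of p]
  by (auto simp: parity_sign_def subspace_0[OF subspace_part])

lemma parity_map_add: "P (x + y) = P x + P y"
proof -
  obtain a b where x: "a \<in> lpart L 0" "b \<in> lpart L 1" "x = a + b" by (rule part_decompE)
  obtain c d where y: "c \<in> lpart L 0" "d \<in> lpart L 1" "y = c + d" by (rule part_decompE)
  have "P ((a + c) + (b + d)) = (a + c) - (b + d)"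
    using x y by (intro parity_map_decomp) (auto simp: subspace_add[OF subspace_part])
  then show ?thesis using x y by (simp add: parity_map_decomp algebra_simps)
qed

lemma parity_map_scale: "P (lscale L c x) = lscale L c (P x)"
proof -
  obtain a b where x: "a \<in> lpart L 0" "b \<in> lpart L 1" "x = a + b" by (rule part_decompE)
  have "P (lscale L c a + lscale L c b) = lscale L c a - lscale L c b"
    using x by (intro parity_map_decomp) (auto simp: subspace_scale[OF subspace_part])
  then show ?thesis using x
    by (simp add: parity_map_decomp scale_right_distrib scale_right_diff_distrib)
qed

lemma parity_map_involution: "P (P x) = x"
proof -
  obtain a b where x: "a \<in> lpart L 0" "b \<in> lpart L 1" "x = a + b" by (rule part_decompE)
  then have "P (a + - b) = a - - b"
    by (intro parity_map_decomp) (auto simp: subspace_neg[OF subspace_part])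
  with x show ?thesis by (simp add: parity_map_decomp)
qed

lemma parity_map_br:
  assumes "x \<in> lpart L p" "y \<in> lpart L q"
  shows "P (lbr L x y) = lbr L (P x) (P y)"
  using parity_map_part[OF br_part[OF assms]] parity_map_part[OF assms(1)]
    parity_map_part[OF assms(2)]
  by (simp add: parity_sign_add del: add_bit_eq_xor)

definition word_parity :: "'g free_word \<Rightarrow> 'g free_word" where
  "word_parity k = Word (map P (letters k))"

lemma word_parity_involution: "word_parity (word_parity k) = k"
  by (cases k) (simp add: word_parity_def parity_map_involution o_def)

lemma inj_word_parity: "inj word_parity"
  by (metis injI word_parity_involution)

text \<open>The endomorphism of the free algebra induced by the parity map on letters. Pulling coefficients
  back along \<open>word_parity\<close> is the same as pushing words forward, because it is an involution.\<close>

definition parity_hom :: "'g free_alg \<Rightarrow> 'g free_alg" where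
  "parity_hom = Poly_Mapping.map_key word_parity"

lemma parity_hom_single: "parity_hom (Poly_Mapping.single k c) = Poly_Mapping.single (word_parity k) c"
  using map_key_single[OF inj_word_parity, of "word_parity k" c]
  by (simp add: parity_hom_def word_parity_involution)

lemma parity_hom_add: "parity_hom (s + t) = parity_hom s + parity_hom t"
  by (simp add: parity_hom_def map_key_plus[OF inj_word_parity])

lemma parity_hom_0: "parity_hom 0 = 0"
  by (simp add: parity_hom_def map_key_zero[OF inj_word_parity])

lemma parity_hom_diff: "parity_hom (s - t) = parity_hom s - parity_hom t"
  using parity_hom_add[of "s - t" t] by simp

lemma parity_hom_mult: "parity_hom (s * t) = parity_hom s * parity_hom t"
proof (induction s rule: poly_mapping_additive_induct)
  case (single k c)
  show ?case
  proof (induction t rule: poly_mapping_additive_induct)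
    case (single l d)
    have "word_parity (k + l) = word_parity k + word_parity l"
      by (simp add: word_parity_def plus_free_word_def)
    then show ?case by (simp add: parity_hom_single mult_single)
  qed (simp_all add: parity_hom_0 parity_hom_add algebra_simps)
qed (simp_all add: parity_hom_0 parity_hom_add algebra_simps)

lemma parity_hom_gen: "parity_hom (gen x) = gen (P x)"
  by (simp add: gen_def parity_hom_single word_parity_def)

lemma parity_hom_const: "parity_hom (const c) = const c"
  by (simp add: const_def parity_hom_single word_parity_def zero_free_word_def)

text \<open>The parity map is an automorphism of \<open>\<gg>\<close>, so \<open>parity_hom\<close> maps each defining relation of
  \<open>U(\<gg>)\<close> to a defining relation.\<close>

lemma parity_hom_env_ideal: "t \<in> env_ideal L \<Longrightarrow> parity_hom t \<in> env_ideal L"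
proof -
  have "ideal {t. parity_hom t \<in> env_ideal L} free_ring"
  proof (rule idealI[OF ring_free_ring])
    interpret ring "free_ring :: 'g free_alg ring" by (rule ring_free_ring)
    show "subgroup {t. parity_hom t \<in> env_ideal L} (add_monoid free_ring)"
    proof (rule group.subgroupI[OF a_group])
      show "inv\<^bsub>add_monoid free_ring\<^esub> t \<in> {t. parity_hom t \<in> env_ideal L}"
        if "t \<in> {t. parity_hom t \<in> env_ideal L}" for t
        using that parity_hom_diff[of 0 t] free_ring_uminus[of t] env_ideal_uminus
        by (simp add: a_inv_def parity_hom_0)
      show "{t. parity_hom t \<in> env_ideal L} \<noteq> {}" by (auto intro!: exI[of _ 0] simp: parity_hom_0)
    qed (simp_all add: free_ring_def parity_hom_add env_ideal_add)
  qed (simp_all add: free_ring_def parity_hom_mult env_ideal_lmult env_ideal_rmult)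
  moreover have "env_relations L \<subseteq> {t. parity_hom t \<in> env_ideal L}"
  proof
    fix t assume "t \<in> env_relations L"
    then consider x y where "t = gen (x + y) - (gen x + gen y)"
      | c x where "t = gen (lscale L c x) - const c * gen x"
      | x y p q where "x \<in> lpart L p" "y \<in> lpart L q"
        "t = gen x * gen y - const (koszul p q) * (gen y * gen x) - gen (lbr L x y)"
      unfolding env_relations_def by blast
    then show "t \<in> {t. parity_hom t \<in> env_ideal L}"
    proof cases
      case 1
      then show ?thesis by (simp add: parity_hom_diff parity_hom_add parity_hom_gen parity_map_add env_ideal_gen_add)
    next
      case 2
      then show ?thesis
        by (simp add: parity_hom_diff parity_hom_mult parity_hom_const parity_hom_gen parity_map_scale env_ideal_gen_scale)
    next
      case 3
      have "P x \<in> lpart L p" "P y \<in> lpart L q"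
        using 3 by (simp_all add: parity_map_part subspace_scale[OF subspace_part])
      then show ?thesis
        using env_ideal_gen_br[of "P x" L p "P y" q] 3
        by (simp add: parity_hom_diff parity_hom_mult parity_hom_const parity_hom_gen parity_map_br)
    qed
  qed
  ultimately show "t \<in> env_ideal L \<Longrightarrow> parity_hom t \<in> env_ideal L"
    using ring.genideal_minimal[OF ring_free_ring, of "{t. parity_hom t \<in> env_ideal L}" "env_relations L"]
    unfolding env_ideal_def by blast
qed

lemma env_ring_simps:
  "env_class L s \<oplus>\<^bsub>env_ring L\<^esub> env_class L t = env_class L (s + t)"
  "env_class L s \<otimes>\<^bsub>env_ring L\<^esub> env_class L t = env_class L (s * t)"
  "\<one>\<^bsub>env_ring L\<^esub> = env_class L 1" "\<zero>\<^bsub>env_ring L\<^esub> = env_class L 0"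
  "env_smult L c (env_class L t) = env_class L (const c * t)"
  using env_class_add[of L s t] env_class_mult[of L s t] env_class_one[of L] env_class_zero[of L]
    env_class_smult[where L = L and c = c and t = t]
  by (simp_all add: enveloping_def)

text \<open>Homogeneous elements are eigenvectors of the parity automorphism.\<close>

lemma env_homogeneous_parity:
  assumes "env_homogeneous L p X"
  shows "\<exists>t. X = env_class L t \<and> env_class L (parity_hom t) = env_class L (const (parity_sign p) * t)"
  using assms
proof (induction rule: env_homogeneous.induct)
  case (zero p)
  show ?case by (rule exI[of _ 0]) (simp add: env_ring_simps parity_hom_0)
next
  case one
  show ?case
    using parity_hom_const[of 1] by (intro exI[of _ 1]) (simp add: env_ring_simps parity_sign_def)
next
  case (add p X Y)
  then obtain s t where
    "X = env_class L s" "env_class L (parity_hom s) = env_class L (const (parity_sign p) * s)"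
    "Y = env_class L t" "env_class L (parity_hom t) = env_class L (const (parity_sign p) * t)" by blast
  then show ?case
    using env_ring_simps(1)[of "parity_hom s" "parity_hom t"]
    by (intro exI[of _ "s + t"]) (simp add: env_ring_simps parity_hom_add distrib_left)
next
  case (smult p X c)
  then obtain t where t: "X = env_class L t"
    "env_class L (parity_hom t) = env_class L (const (parity_sign p) * t)" by blast
  have "env_class L (parity_hom (const c * t)) = env_class L (const c) \<otimes>\<^bsub>env_ring L\<^esub> env_class L (parity_hom t)"
    by (simp add: parity_hom_mult parity_hom_const env_ring_simps)
  also have "\<dots> = env_class L (const c * (const (parity_sign p) * t))"
    by (simp add: t env_ring_simps)
  also have "const c * (const (parity_sign p) * t) = const (parity_sign p) * (const c * t)"
    by (simp add: mult.assoc[symmetric] const_mult mult.commute)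
  finally show ?case using t by (intro exI[of _ "const c * t"]) (simp add: env_ring_simps)
next
  case (embed x p q X)
  then obtain t where t: "X = env_class L t"
    "env_class L (parity_hom t) = env_class L (const (parity_sign q) * t)" by blast
  have "env_class L (gen (P x)) = env_class L (const (parity_sign p) * gen x)"
    using env_ideal_gen_scale[of L "parity_sign p" x] parity_map_part[OF embed(1)]
    by (simp add: env_class_eq_iff)
  then have "env_class L (parity_hom (gen x * t)) =
      env_class L (const (parity_sign p) * gen x) \<otimes>\<^bsub>env_ring L\<^esub> env_class L (const (parity_sign q) * t)"
    by (simp only: parity_hom_mult parity_hom_gen t(2) flip: env_ring_simps(2))
  also have "\<dots> = env_class L (const (parity_sign p) * (gen x * const (parity_sign q)) * t)"
    by (simp add: env_ring_simps mult.assoc)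
  also have "const (parity_sign p) * (gen x * const (parity_sign q)) * t =
      const (parity_sign (p + q)) * (gen x * t)"
    by (simp only: const_central[of _ "gen x", symmetric] mult.assoc[symmetric] const_mult
        parity_sign_add)
  finally show ?case
    using t by (intro exI[of _ "gen x * t"]) (simp add: env_embed_def env_ring_simps)
qed

lemma parity_hom_cong: "env_class L s = env_class L t \<Longrightarrow> env_class L (parity_hom s) = env_class L (parity_hom t)"
  using parity_hom_env_ideal[of "s - t"] by (simp add: env_class_eq_iff parity_hom_diff)

text \<open>An element of \<open>U(\<gg>)\<^sub>0 \<inter> U(\<gg>)\<^sub>1\<close> is fixed and negated by the parity automorphism.\<close>

lemma homogeneous_both_zero:
  assumes "env_homogeneous L 0 (env_class L d)" "env_homogeneous L 1 (env_class L d)"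
  shows "d \<in> env_ideal L"
proof -
  obtain s t where s: "env_class L d = env_class L s" "env_class L (parity_hom s) = env_class L s"
    and t: "env_class L d = env_class L t" "env_class L (parity_hom t) = env_class L (- t)"
    using env_homogeneous_parity[OF assms(1)] env_homogeneous_parity[OF assms(2)]
    by (auto simp: parity_sign_def const_uminus)
  have "env_class L t = env_class L (- t)"
    using parity_hom_cong[of s t] s t by simp
  then have "t + t \<in> env_ideal L" by (simp add: env_class_eq_iff)
  then have "const (1/2) * (t + t) \<in> env_ideal L" by (rule env_ideal_lmult)
  also have "const (1/2) * (t + t) = (const (1/2) + const (1/2)) * t"
    by (simp add: algebra_simps)
  also have "\<dots> = t" by (simp flip: const_add)
  finally have "t \<in> env_ideal L" .
  then have "(d - t) + t \<in> env_ideal L"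
    using t(1) by (intro env_ideal_add) (simp_all add: env_class_eq_iff)
  then show ?thesis by simp
qed

lemma apart_enveloping: "apart (enveloping L) p = {X. env_homogeneous L p X}"
  by (simp add: enveloping_def)

lemma homogeneous_carrier: "env_homogeneous L p X \<Longrightarrow> \<exists>t. X = env_class L t"
  using env_homogeneous_parity by blast

lemma homogeneous_diff:
  assumes "env_homogeneous L p (env_class L s)" "env_homogeneous L p (env_class L t)"
  shows "env_homogeneous L p (env_class L (s - t))"
  using env_homogeneous.add[OF assms(1) env_homogeneous.smult[OF assms(2), of "-1"]]
  by (simp add: env_ring_simps const_uminus)

lemma homogeneous_gen: "x \<in> lpart L p \<Longrightarrow> env_homogeneous L p (env_class L (gen x))"
  using env_homogeneous.embed[OF _ env_homogeneous.one, where x = x and p = p and L = L]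
  by (simp only: env_embed_def env_ring_simps add_0_right mult_1_right)

end

section \<open>Invariants in the Whittaker quotient\<close>

lemma gen_left_ideal_subset: "left_ideal R K \<Longrightarrow> S \<subseteq> K \<Longrightarrow> gen_left_ideal R S \<subseteq> K"
  by (auto simp: gen_left_ideal_def)

context odd_whittaker
begin

abbreviation I where "I \<equiv> I_chi L (B e) m"

text \<open>The preimage of \<open>I\<^sub>\<chi>\<close> in the free algebra. It is a left ideal containing the relations of \<open>U(\<gg>)\<close>,
  and two elements have the same class in \<open>Q\<^sub>\<chi>\<close> if and only if their difference lies in \<open>J\<close>.\<close>

definition J :: "'g free_alg set" where "J = {t. env_class L t \<in> I}"

lemma I_generators:
  "{env_embed L x \<ominus>\<^bsub>enveloping L\<^esub> (B e x \<odot>\<^bsub>enveloping L\<^esub> \<one>\<^bsub>enveloping L\<^esub>) | x. x \<in> m} =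
    {env_class L (gen x - const (B e x)) | x. x \<in> m}"
  by (simp add: env_embed_def env_class_one env_class_smult env_class_minus)

lemma J_iff:
  "t \<in> J \<longleftrightarrow> (\<forall>K. left_ideal (enveloping L) K \<and>
    (\<forall>x\<in>m. env_class L (gen x - const (B e x)) \<in> K) \<longrightarrow> env_class L t \<in> K)"
  unfolding J_def I_chi_def I_generators gen_left_ideal_def by blast

lemma J_gen: "a \<in> m \<Longrightarrow> gen a - const (B e a) \<in> J"
  by (auto simp: J_iff)

lemma J_env_ideal: "t \<in> env_ideal L \<Longrightarrow> t \<in> J"
proof -
  assume "t \<in> env_ideal L"
  then have t: "env_class L t = \<zero>\<^bsub>enveloping L\<^esub>" by (simp add: env_class_zero env_class_eq_iff)
  show "t \<in> J"
    unfolding J_iff t by (auto simp: left_ideal_def dest: additive_subgroup.zero_closed)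
qed

lemma J_add: "d \<in> J \<Longrightarrow> t \<in> J \<Longrightarrow> d + t \<in> J"
  unfolding J_iff env_class_add[symmetric]
  by (auto simp: left_ideal_def intro!: additive_subgroup.a_closed)

lemma J_lmult: "t \<in> J \<Longrightarrow> d * t \<in> J"
  unfolding J_iff env_class_mult[symmetric]
  by (auto simp: left_ideal_def carrier_enveloping)

lemma J_uminus: "t \<in> J \<Longrightarrow> - t \<in> J"
  using J_lmult[of t "- 1"] by simp

lemma J_diff: "d \<in> J \<Longrightarrow> t \<in> J \<Longrightarrow> d - t \<in> J"
  using J_add[of d "- t"] J_uminus by simp

lemma J_0 [simp]: "0 \<in> J" by (rule J_env_ideal) simp

lemma I_minimal:
  assumes E: "\<And>t. t \<in> env_ideal L \<Longrightarrow> Q t"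
    and gens: "\<And>a. a \<in> m \<Longrightarrow> Q (gen a - const (B e a))"
    and add: "\<And>s t. Q s \<Longrightarrow> Q t \<Longrightarrow> Q (s + t)"
    and lmult: "\<And>s t. Q t \<Longrightarrow> Q (s * t)"
  shows "I \<subseteq> env_class L ` {t. Q t}"
  unfolding I_chi_def I_generators
proof (rule gen_left_ideal_subset)
  interpret ring "enveloping L" by (rule ring_enveloping)
  have inv: "inv\<^bsub>add_monoid (enveloping L)\<^esub> env_class L t = env_class L (- t)" for t
    unfolding a_inv_def[symmetric] by (rule env_class_uminus)
  have "subgroup (env_class L ` {t. Q t}) (add_monoid (enveloping L))"
  proof (rule group.subgroupI[OF a_group])
    show "env_class L ` {t. Q t} \<noteq> {}" using E[of 0] by auto
    show "inv\<^bsub>add_monoid (enveloping L)\<^esub> x \<in> env_class L ` {t. Q t}"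
      if "x \<in> env_class L ` {t. Q t}" for x
    proof -
      from that obtain t where "x = env_class L t" "Q t" by auto
      then show ?thesis using lmult[of t "- 1"] by (auto simp: inv)
    qed
  qed (auto simp: carrier_enveloping env_class_add intro!: imageI add)
  then show "left_ideal (enveloping L) (env_class L ` {t. Q t})"
    unfolding left_ideal_def
    by (auto simp: carrier_enveloping env_class_mult additive_subgroup_def intro!: imageI lmult)
qed (auto intro!: imageI gens)

lemma J_induct [consumes 1, case_names env_ideal gen add lmult]:
  assumes "t \<in> J"
    and E: "\<And>t. t \<in> env_ideal L \<Longrightarrow> Q t"
    and "\<And>a. a \<in> m \<Longrightarrow> Q (gen a - const (B e a))"
    and add: "\<And>s t. Q s \<Longrightarrow> Q t \<Longrightarrow> Q (s + t)"
    and "\<And>s t. Q t \<Longrightarrow> Q (s * t)"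
  shows "Q t"
proof -
  have "env_class L t \<in> env_class L ` {t. Q t}"
    using I_minimal[of Q] assms by (auto simp: J_def)
  then obtain s where "Q s" "t - s \<in> env_ideal L" by (auto simp: env_class_eq_iff)
  then have "Q (s + (t - s))" using add E by blast
  then show ?thesis by simp
qed

abbreviation coset :: "'g free_alg \<Rightarrow> 'g env set" where
  "coset t \<equiv> I +>\<^bsub>enveloping L\<^esub> env_class L t"

lemma coset_eq: "coset t = env_class L ` {s. s - t \<in> J}"
proof (intro equalityI subsetI)
  fix X assume "X \<in> coset t"
  then obtain Y where Y: "Y \<in> I" "X = Y \<oplus>\<^bsub>enveloping L\<^esub> env_class L t"
    by (auto simp: a_r_coset_def')
  moreover obtain y where "Y = env_class L y"
    using I_minimal[of "\<lambda>_. True"] Y(1) by auto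
  ultimately have "X = env_class L (y + t)" "y \<in> J" by (auto simp: env_class_add J_def)
  then show "X \<in> env_class L ` {s. s - t \<in> J}" by auto
next
  fix X assume "X \<in> env_class L ` {s. s - t \<in> J}"
  then obtain s where "X = env_class L s" "s - t \<in> J" by auto
  then have "X = env_class L (s - t) \<oplus>\<^bsub>enveloping L\<^esub> env_class L t" "env_class L (s - t) \<in> I"
    by (auto simp: env_class_add J_def)
  then show "X \<in> coset t" by (auto simp: a_r_coset_def')
qed

lemma J_translate_nonempty: "{x. x - t \<in> J} \<noteq> {}"
proof -
  have "t \<in> {x. x - t \<in> J}" by simp
  then show ?thesis by blast
qed

lemma coset_cong:
  assumes "d - t \<in> J"
  shows "coset d = coset t"
proof -
  have "x - d \<in> J \<longleftrightarrow> x - t \<in> J" for x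
    using J_add[OF _ assms, of "x - d"] J_diff[OF _ assms, of "x - t"] by auto
  then show ?thesis by (simp add: coset_eq)
qed

text \<open>Changing the first factor by \<open>j \<in> J\<close> changes the product by \<open>j * t\<close>, which is why right stability of
  \<open>J\<close> under \<open>t\<close> is needed; for the second factor it is enough that \<open>J\<close> is a left ideal.\<close>

lemma coset_mult:
  assumes "\<And>j. j \<in> J \<Longrightarrow> j * t \<in> J"
  shows "rcoset_mult (enveloping L) I (coset d) (coset t) = coset (d * t)"
proof -
  have *: "coset (x * y) = coset (d * t)" if "x - d \<in> J" "y - t \<in> J" for x y
  proof -
    have "x * (y - t) + (x - d) * t \<in> J" using that assms J_add J_lmult by blast
    then show ?thesis by (intro coset_cong) (simp add: algebra_simps)
  qed
  have "rcoset_mult (enveloping L) I (coset d) (coset t) =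
      (\<Union>x\<in>{x. x - d \<in> J}. \<Union>y\<in>{y. y - t \<in> J}. coset (x * y))"
    unfolding rcoset_mult_def coset_eq[of d] coset_eq[of t] by (simp add: env_class_mult)
  also have "\<dots> = coset (d * t)"
    by (intro SUP_eq_const J_translate_nonempty *) auto
  finally show ?thesis .
qed

lemma coset_smult:
  "(\<Union>X\<in>coset t. I +>\<^bsub>enveloping L\<^esub> (c \<odot>\<^bsub>enveloping L\<^esub> X)) = coset (const c * t)"
proof -
  have "coset (const c * x) = coset (const c * t)" if "x - t \<in> J" for x
    using J_lmult[OF that, of "const c"] by (intro coset_cong) (simp add: algebra_simps)
  then have "(\<Union>x\<in>{x. x - t \<in> J}. coset (const c * x)) = coset (const c * t)"
    by (intro SUP_eq_const J_translate_nonempty) blast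
  then show ?thesis unfolding coset_eq[of t] by (simp add: env_class_smult)
qed

text \<open>The class of \<open>t0 + t1\<close> in \<open>Q\<^sub>\<chi>\<close>, with even \<open>t0\<close> and odd \<open>t1\<close>, is killed by \<open>ad n\<close>.\<close>

definition ad_annihilated :: "'g set \<Rightarrow> 'g free_alg \<Rightarrow> 'g free_alg \<Rightarrow> bool" where
  "ad_annihilated n t0 t1 \<longleftrightarrow> (\<forall>p. \<forall>a\<in>n \<inter> lpart L p.
     (gen a * t0 - const (koszul p 0) * (t0 * gen a)) +
     (gen a * t1 - const (koszul p 1) * (t1 * gen a)) \<in> J)"

lemma ad_invariant_iff:
  "ad_invariant L I n X \<longleftrightarrow> (\<exists>t0 t1. env_homogeneous L 0 (env_class L t0) \<and>
     env_homogeneous L 1 (env_class L t1) \<and> X = env_class L (t0 + t1) \<and> ad_annihilated n t0 t1)"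
proof -
  have ad: "supercommutator (enveloping L) p 0 (env_embed L a) (env_class L t0) \<oplus>\<^bsub>enveloping L\<^esub>
      supercommutator (enveloping L) p 1 (env_embed L a) (env_class L t1) \<in> I \<longleftrightarrow>
     (gen a * t0 - const (koszul p 0) * (t0 * gen a)) +
     (gen a * t1 - const (koszul p 1) * (t1 * gen a)) \<in> J" for p a t0 t1
    by (simp add: supercommutator_def env_embed_def env_class_mult env_class_smult
        env_class_minus env_class_add J_def)
  show ?thesis
  proof
    assume "ad_invariant L I n X"
    then obtain X0 X1 where X: "env_homogeneous L 0 X0" "env_homogeneous L 1 X1"
      "X = X0 \<oplus>\<^bsub>enveloping L\<^esub> X1"
      "\<And>p a. a \<in> n \<inter> lpart L p \<Longrightarrow>
        supercommutator (enveloping L) p 0 (env_embed L a) X0 \<oplus>\<^bsub>enveloping L\<^esub>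
        supercommutator (enveloping L) p 1 (env_embed L a) X1 \<in> I"
      unfolding ad_invariant_def apart_enveloping by blast
    obtain t0 t1 where "X0 = env_class L t0" "X1 = env_class L t1"
      using homogeneous_carrier X(1,2) by blast
    with X show "\<exists>t0 t1. env_homogeneous L 0 (env_class L t0) \<and>
     env_homogeneous L 1 (env_class L t1) \<and> X = env_class L (t0 + t1) \<and> ad_annihilated n t0 t1"
      unfolding ad_annihilated_def ad[symmetric] by (auto simp: env_class_add)
  next
    assume "\<exists>t0 t1. env_homogeneous L 0 (env_class L t0) \<and>
     env_homogeneous L 1 (env_class L t1) \<and> X = env_class L (t0 + t1) \<and> ad_annihilated n t0 t1"
    then obtain t0 t1 where "env_homogeneous L 0 (env_class L t0)"
      "env_homogeneous L 1 (env_class L t1)" "X = env_class L (t0 + t1)" "ad_annihilated n t0 t1"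
      by blast
    then show "ad_invariant L I n X"
      unfolding ad_annihilated_def ad_invariant_def apart_enveloping ad[symmetric]
      by (intro bexI[of _ "env_class L t0"] bexI[of _ "env_class L t1"]) (simp_all add: env_class_add)
  qed
qed

text \<open>For homogeneous \<open>a \<in> \<mm>\<close> the product \<open>(a - \<chi>(a)) t\<close> agrees modulo \<open>[a, t] \<in> I\<^sub>\<chi>\<close> with a combination of
  the \<open>t\<^sub>i (a - \<chi>(a))\<close>, which lie in the left ideal. The signs do no harm since \<open>\<chi>(a) = 0\<close> for odd \<open>a\<close>.\<close>

lemma ad_annihilated_right_stable:
  assumes inv: "ad_annihilated m t0 t1" and t: "t - (t0 + t1) \<in> env_ideal L" and j: "j \<in> J"
  shows "j * t \<in> J"
  using j
proof (induction rule: J_induct)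
  case (env_ideal j)
  then show ?case by (intro J_env_ideal env_ideal_rmult)
next
  case (add s j)
  then show ?case by (simp add: distrib_right J_add)
next
  case (lmult s j)
  then show ?case by (simp add: mult.assoc J_lmult)
next
  case (gen a)
  have hom: "(gen a - const (B e a)) * t \<in> J" if a: "a \<in> m" "a \<in> lpart L p" for a p
  proof -
    let ?c = "const (B e a)"
    have chi: "const (koszul p 1) * ?c = ?c"
      using a(2) chi_odd[of a] bit_cases[of p] by (auto simp: koszul_def)
    have "(gen a * t0 - const (koszul p 0) * (t0 * gen a)) +
        (gen a * t1 - const (koszul p 1) * (t1 * gen a)) \<in> J"
      using inv a unfolding ad_annihilated_def by blast
    then have "gen a * t0 - t0 * gen a + (gen a * t1 - const (koszul p 1) * (t1 * gen a)) \<in> J"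
      by (simp add: koszul_def)
    moreover have "t0 * (gen a - ?c) + const (koszul p 1) * (t1 * (gen a - ?c)) \<in> J"
      using a(1) by (intro J_add J_lmult J_gen)
    ultimately have "(gen a * t0 - t0 * gen a + (gen a * t1 - const (koszul p 1) * (t1 * gen a))) +
        (t0 * (gen a - ?c) + const (koszul p 1) * (t1 * (gen a - ?c))) \<in> J" (is "?z \<in> J")
      by (rule J_add)
    also have "?z = gen a * (t0 + t1) - t0 * ?c - const (koszul p 1) * (t1 * ?c)"
      by (simp add: algebra_simps)
    also have "const (koszul p 1) * (t1 * ?c) = (const (koszul p 1) * ?c) * t1"
      by (simp add: const_central[of _ t1, symmetric] mult.assoc)
    also have "gen a * (t0 + t1) - t0 * ?c - (const (koszul p 1) * ?c) * t1 =
        (gen a - ?c) * (t0 + t1)"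
      unfolding chi by (simp add: algebra_simps const_central[of _ t0])
    finally have "(gen a - ?c) * (t0 + t1) \<in> J" .
    moreover have "(gen a - ?c) * (t - (t0 + t1)) \<in> J"
      using t by (intro J_env_ideal env_ideal_lmult)
    ultimately have "(gen a - ?c) * (t0 + t1) + (gen a - ?c) * (t - (t0 + t1)) \<in> J" by (rule J_add)
    then show ?thesis by (simp add: distrib_left[symmetric])
  qed
  obtain a0 a1 where a: "a0 \<in> m" "a0 \<in> lpart L 0" "a1 \<in> m" "a1 \<in> lpart L 1" "a = a0 + a1"
    using m_graded[OF gen] by blast
  have "(gen a - (gen a0 + gen a1)) * t \<in> J"
    unfolding a(5) by (intro J_env_ideal env_ideal_rmult env_ideal_gen_add)
  then have "(gen a - (gen a0 + gen a1)) * t +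
      ((gen a0 - const (B e a0)) * t + (gen a1 - const (B e a1)) * t) \<in> J" (is "?z \<in> J")
    using hom a by (intro J_add) auto
  also have "?z = (gen a - const (B e a)) * t"
    by (simp add: a(5) const_add algebra_simps)
  finally show ?case .
qed

lemma ad_invariant_right_stable:
  assumes "ad_invariant L I m (env_class L t)" "j \<in> J"
  shows "j * t \<in> J"
  using assms ad_annihilated_right_stable unfolding ad_invariant_iff env_class_eq_iff by blast

lemma ad_invariant_antimono: "n \<subseteq> n' \<Longrightarrow> ad_invariant L I n' X \<Longrightarrow> ad_invariant L I n X"
  unfolding ad_invariant_iff ad_annihilated_def by blast

lemma ad_invariant_one: "ad_invariant L I n (env_class L 1)"
  unfolding ad_invariant_iff
proof (intro exI conjI)
  show "env_homogeneous L 0 (env_class L 1)"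
    using env_homogeneous.one[of L] by (simp add: env_ring_simps)
  show "env_homogeneous L 1 (env_class L 0)"
    using env_homogeneous.zero[of L 1] by (simp add: env_ring_simps)
qed (simp_all add: ad_annihilated_def koszul_def)

text \<open>The multiples are needed because a sign appears when \<open>\<Theta>\<close> is moved past an odd element.\<close>

lemma ad_invariant_scaled_mid: "ad_invariant L I m (env_class L (const c * gen v_mid))"
  unfolding ad_invariant_iff
proof (intro exI conjI)
  show "env_homogeneous L 0 (env_class L 0)"
    using env_homogeneous.zero[of L 0] by (simp add: env_ring_simps)
  show "env_homogeneous L 1 (env_class L (const c * gen v_mid))"
    using env_homogeneous.smult[OF homogeneous_gen[OF mid_odd], of c] by (simp add: env_ring_simps)
  show "ad_annihilated m 0 (const c * gen v_mid)"
    unfolding ad_annihilated_def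
  proof (intro allI ballI)
    fix p a assume a: "a \<in> m \<inter> lpart L p"
    then have "gen a * gen v_mid - const (koszul p 1) * (gen v_mid * gen a) - gen (lbr L a v_mid) \<in> J"
      using mid_odd by (intro J_env_ideal env_ideal_gen_br) auto
    moreover have "gen (lbr L a v_mid) \<in> J"
      using J_gen[of "lbr L a v_mid"] ad_mid_m[of a] a by simp
    ultimately have "gen a * gen v_mid - const (koszul p 1) * (gen v_mid * gen a) - gen (lbr L a v_mid)
        + gen (lbr L a v_mid) \<in> J" by (rule J_add)
    then have "const c * (gen a * gen v_mid - const (koszul p 1) * (gen v_mid * gen a)) \<in> J"
      by (intro J_lmult) simp
    also have "const c * (gen a * gen v_mid - const (koszul p 1) * (gen v_mid * gen a)) =
        gen a * (const c * gen v_mid) - const (koszul p 1) * (const c * gen v_mid * gen a)"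
      by (simp add: right_diff_distrib mult.assoc[symmetric] const_mult const_central[of c "gen a"]
          mult.commute[of c])
    finally show "(gen a * 0 - const (koszul p 0) * (0 * gen a)) +
        (gen a * (const c * gen v_mid) - const (koszul p 1) * (const c * gen v_mid * gen a)) \<in> J" by simp
  qed
qed simp

abbreviation U where "U \<equiv> finite_W L (B e) h s u r v"
abbreviation W' where "W' \<equiv> refined_W L (B e) h s u r v"

definition \<Theta> where "\<Theta> = coset (gen v_mid)"

lemma theta_odd: "\<Theta> \<in> apart U 1"
  using homogeneous_gen[OF mid_odd] ad_invariant_scaled_mid[of 1]
  by (auto simp: \<Theta>_def finite_W_def invariants_def apart_enveloping)

lemma smult_theta: "c \<odot>\<^bsub>U\<^esub> \<Theta> = coset (const c * gen v_mid)"
  by (simp add: \<Theta>_def finite_W_def invariants_def coset_smult)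

lemma smult_theta_carrier: "c \<odot>\<^bsub>U\<^esub> \<Theta> \<in> carrier U"
  unfolding smult_theta using ad_invariant_scaled_mid[of c]
  by (auto simp: finite_W_def invariants_def)

lemma apart_subset_carrier: "apart U p \<subseteq> carrier U"
  by (auto simp: finite_W_def invariants_def)

lemma theta_carrier: "\<Theta> \<in> carrier U"
  using theta_odd apart_subset_carrier by blast

lemma one_carrier: "\<one>\<^bsub>U\<^esub> \<in> carrier U"
  using ad_invariant_one[of m] by (auto simp: finite_W_def invariants_def env_class_one)

text \<open>\<open>2 v_mid\<^sup>2 = [v_mid, v_mid]\<close>, and \<open>[v_mid, v_mid] \<in> \<mm>\<close> acts on the generator of \<open>Q\<^sub>\<chi>\<close> by
  \<open>\<chi>([v_mid, v_mid]) = 1\<close>.\<close>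

lemma theta_square: "\<Theta> \<otimes>\<^bsub>U\<^esub> \<Theta> = (1/2) \<odot>\<^bsub>U\<^esub> \<one>\<^bsub>U\<^esub>"
proof -
  have "\<Theta> \<otimes>\<^bsub>U\<^esub> \<Theta> = coset (gen v_mid * gen v_mid)"
    using ad_invariant_right_stable[OF ad_invariant_scaled_mid[of 1]]
    by (simp add: \<Theta>_def finite_W_def invariants_def coset_mult)
  also have "\<dots> = coset (const (1/2) * 1)"
  proof (rule coset_cong)
    have "gen v_mid * gen v_mid - const (koszul 1 1) * (gen v_mid * gen v_mid) - gen (lbr L v_mid v_mid) \<in> J"
      by (intro J_env_ideal env_ideal_gen_br mid_odd)
    moreover have "gen (lbr L v_mid v_mid) - 1 \<in> J"
      using J_gen[OF mid_square_in_m] by (simp add: chi_mid_square)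
    ultimately have "gen v_mid * gen v_mid - const (koszul 1 1) * (gen v_mid * gen v_mid) - gen (lbr L v_mid v_mid)
        + (gen (lbr L v_mid v_mid) - 1) \<in> J" by (rule J_add)
    then have "gen v_mid * gen v_mid + gen v_mid * gen v_mid - 1 \<in> J"
      by (simp add: koszul_def const_uminus)
    then have "const (1/2) * (gen v_mid * gen v_mid + gen v_mid * gen v_mid - 1) \<in> J" (is "?z \<in> J")
      by (rule J_lmult)
    also have "?z = (const (1/2) + const (1/2)) * (gen v_mid * gen v_mid) - const (1/2) * 1"
      by (simp add: algebra_simps)
    also have "const (1/2) + const (1/2) = (1 :: 'g free_alg)"
      by (simp flip: const_add)
    finally show "gen v_mid * gen v_mid - const (1/2) * 1 \<in> J" by simp
  qed
  also have "\<dots> = (1/2) \<odot>\<^bsub>U\<^esub> \<one>\<^bsub>U\<^esub>"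
    unfolding coset_smult[symmetric] by (simp add: finite_W_def invariants_def env_class_one)
  finally show ?thesis .
qed

lemma refined_subset: "carrier W' \<subseteq> carrier U" "apart W' p \<subseteq> apart U p"
  using ad_invariant_antimono[OF m_subset_m']
  by (auto simp: finite_W_def refined_W_def invariants_def)

lemma refined_operations:
  "mult W' = mult U" "one W' = one U" "add W' = add U" "smult W' = smult U"
  by (simp_all add: finite_W_def refined_W_def invariants_def)

text \<open>This is the invariance under the additional element \<open>v_mid\<close> of \<open>\<mm>'\<close>. The components \<open>t0\<close> and \<open>t1\<close>
  supplied by invariance are those of the homogeneous element \<open>t\<close>, that is, one of them vanishes,
  because \<open>U(\<gg>)\<^sub>0 \<inter> U(\<gg>)\<^sub>1 = 0\<close>.\<close>

lemma refined_supercommutes_theta: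
  assumes "X \<in> apart W' p"
  shows "X \<otimes>\<^bsub>U\<^esub> \<Theta> = (koszul 1 p \<odot>\<^bsub>U\<^esub> \<Theta>) \<otimes>\<^bsub>U\<^esub> X"
proof -
  obtain t where X: "X = coset t" and t: "env_homogeneous L p (env_class L t)"
    and inv: "ad_invariant L I m' (env_class L t)"
    using assms homogeneous_carrier
    by (auto simp: refined_W_def invariants_def apart_enveloping)
  from inv obtain t0 t1 where t0: "env_homogeneous L 0 (env_class L t0)"
    and t1: "env_homogeneous L 1 (env_class L t1)" and eq: "env_class L t = env_class L (t0 + t1)"
    and ann: "ad_annihilated m' t0 t1"
    unfolding ad_invariant_iff by blast
  have ad_w: "gen v_mid * t0 - t0 * gen v_mid + (gen v_mid * t1 + t1 * gen v_mid) \<in> J"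
    using ann mid_in_m' mid_odd unfolding ad_annihilated_def
    by (force simp: koszul_def const_uminus)
  have "gen v_mid * t - const (koszul 1 p) * (t * gen v_mid) \<in> J"
  proof (cases "p = 0")
    case True
    have "env_class L (t - t0) = env_class L t1"
      using eq by (simp add: env_class_eq_iff algebra_simps)
    moreover have "env_homogeneous L 0 (env_class L (t - t0))"
      using t t0 True by (intro homogeneous_diff) auto
    ultimately have d: "t - t0 \<in> env_ideal L" "t1 \<in> env_ideal L"
      using t1 homogeneous_both_zero by metis+
    have "gen v_mid * (t - t0) - (t - t0) * gen v_mid - (gen v_mid * t1 + t1 * gen v_mid) \<in> J"
      using d by (simp add: J_env_ideal env_ideal_diff env_ideal_add env_ideal_lmult env_ideal_rmult)
    then have "(gen v_mid * t0 - t0 * gen v_mid + (gen v_mid * t1 + t1 * gen v_mid)) +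
        (gen v_mid * (t - t0) - (t - t0) * gen v_mid - (gen v_mid * t1 + t1 * gen v_mid)) \<in> J"
      using ad_w J_add by blast
    then show ?thesis using True by (simp add: koszul_def algebra_simps)
  next
    case False
    then have p: "p = 1" using bit_cases by blast
    have "env_class L (t - t1) = env_class L t0"
      using eq by (simp add: env_class_eq_iff algebra_simps)
    moreover have "env_homogeneous L 1 (env_class L (t - t1))"
      using t t1 p by (intro homogeneous_diff) auto
    ultimately have d: "t - t1 \<in> env_ideal L" "t0 \<in> env_ideal L"
      using t0 homogeneous_both_zero by metis+
    have "gen v_mid * (t - t1) + (t - t1) * gen v_mid - (gen v_mid * t0 - t0 * gen v_mid) \<in> J"
      using d by (simp add: J_env_ideal env_ideal_diff env_ideal_add env_ideal_lmult env_ideal_rmult)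
    then have "(gen v_mid * t0 - t0 * gen v_mid + (gen v_mid * t1 + t1 * gen v_mid)) +
        (gen v_mid * (t - t1) + (t - t1) * gen v_mid - (gen v_mid * t0 - t0 * gen v_mid)) \<in> J"
      using ad_w J_add by blast
    then show ?thesis using p by (simp add: koszul_def const_uminus algebra_simps)
  qed
  then have "- (const (koszul 1 p) * (gen v_mid * t - const (koszul 1 p) * (t * gen v_mid))) \<in> J" (is "?z \<in> J")
    by (intro J_uminus J_lmult)
  also have "?z = t * gen v_mid - const (koszul 1 p) * gen v_mid * t"
    by (cases "p = 1") (simp_all add: koszul_def const_uminus)
  finally have "coset (t * gen v_mid) = coset (const (koszul 1 p) * gen v_mid * t)" by (rule coset_cong)
  moreover have "X \<otimes>\<^bsub>U\<^esub> \<Theta> = coset (t * gen v_mid)"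
    using ad_invariant_right_stable[OF ad_invariant_scaled_mid[of 1]]
    by (simp add: X \<Theta>_def finite_W_def invariants_def coset_mult)
  moreover have "(koszul 1 p \<odot>\<^bsub>U\<^esub> \<Theta>) \<otimes>\<^bsub>U\<^esub> X = coset (const (koszul 1 p) * gen v_mid * t)"
    using ad_invariant_right_stable[OF ad_invariant_antimono[OF m_subset_m' inv]]
    unfolding smult_theta by (simp add: X finite_W_def invariants_def coset_mult)
  ultimately show ?thesis by simp
qed

end

section \<open>Two-dimensional super spaces with an odd square root of 1/2\<close>

lemma (in vector_space) finite_dimensional_if_dim_pos:
  assumes "0 < dim UNIV"
  obtains Basis where "finite_dimensional_vector_space scale Basis"
proof -
  obtain Bs where Bs: "independent Bs" "UNIV \<subseteq> span Bs" "card Bs = dim UNIV"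
    using basis_exists[of UNIV] by blast
  have "finite_dimensional_vector_space scale Bs"
    using Bs assms card_gt_0_iff[of Bs] by unfold_locales auto
  then show ?thesis by (rule that)
qed

lemma (in vector_space) UNIV_nontrivial_if_dim_pos: "0 < dim UNIV \<Longrightarrow> (UNIV :: 'b set) \<noteq> {0}"
  using dim_le_card[of "{0}" "{}"] by auto

context super_space
begin

lemma part_inter:
  assumes "x \<in> part p" "x \<in> part (p + 1)"
  shows "x = 0"
proof -
  have "x \<in> part 0 \<inter> part 1"
  proof (cases "p = 0")
    case True
    with assms show ?thesis by simp
  next
    case False
    then have "p = 1" by simp
    with assms show ?thesis by simp
  qed
  then show ?thesis by (simp add: part_disjoint)
qed

lemma opposite_parity_independent:
  assumes "x \<in> part p" "y \<in> part (p + 1)" "x \<noteq> 0" "y \<noteq> 0"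
  shows "independent {x, y}" "x \<noteq> y"
proof -
  show "x \<noteq> y" using part_inter assms by blast
  have "x \<notin> span {y}"
    using part_inter[OF assms(1)] assms(2,3) subspace_scale[OF subspace_part]
    by (auto simp: span_singleton)
  with assms \<open>x \<noteq> y\<close> show "independent {x, y}"
    by (simp add: independent_insert dependent_single)
qed

text \<open>Non-zero vectors of opposite parity are independent, so two of them fill a two-dimensional space.\<close>

lemma opposite_parity_dim:
  assumes "0 < dim UNIV" "x \<in> part p" "y \<in> part (p + 1)" "x \<noteq> 0" "y \<noteq> 0"
  shows "2 \<le> dim UNIV" "dim UNIV = 2 \<Longrightarrow> span {x, y} = UNIV"
proof -
  obtain Basis where "finite_dimensional_vector_space scale Basis"
    using finite_dimensional_if_dim_pos[OF assms(1)] .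
  then interpret fd: finite_dimensional_vector_space scale Basis .
  have *: "independent {x, y}" "card {x, y} = 2"
    using opposite_parity_independent[OF assms(2-5)] by auto
  show "2 \<le> dim UNIV" using fd.independent_card_le_dim[of "{x, y}" UNIV] * by simp
  show "span {x, y} = UNIV" if "dim UNIV = 2"
    using fd.card_ge_dim_independent[of "{x, y}" UNIV] * that by auto
qed

lemma exists_homogeneous:
  assumes "subspace N" "N \<noteq> {0}" "\<And>z. z \<in> N \<Longrightarrow> \<exists>a\<in>N \<inter> part 0. \<exists>b\<in>N \<inter> part 1. z = a + b"
  obtains x p where "x \<in> N" "x \<in> part p" "x \<noteq> 0"
proof -
  from assms(1,2) obtain z where "z \<in> N" "z \<noteq> 0" using subspace_0 by blast
  with assms(3)[of z] show ?thesis using that by (metis IntD1 IntD2 add_0_left)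
qed

end

lemma supermodule_super_space: "supermodule A V \<Longrightarrow> super_space (mscale V) (mpart V)"
  by (simp add: supermodule_def)

text \<open>A non-zero graded submodule contains a homogeneous vector and then one of the opposite parity.\<close>

lemma irreducible_supermodule_if_parity_swapped:
  fixes V :: "('a, 'v::ab_group_add) supermod"
  assumes V: "supermodule A V" "mdim V = 2"
    and swap: "\<And>p z. z \<in> mpart V p \<Longrightarrow> z \<noteq> 0 \<Longrightarrow>
      \<exists>x\<in>carrier A. act V x z \<in> mpart V (p + 1) \<and> act V x z \<noteq> 0"
  shows "irreducible_supermodule A V"
proof -
  interpret super_space "mscale V" "mpart V" using V(1) by (rule supermodule_super_space)
  have "(UNIV :: 'v set) \<noteq> {0}" using V(2) by (intro UNIV_nontrivial_if_dim_pos) simp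
  moreover have "N = UNIV" if N: "subsupermodule A V N" "N \<noteq> {0}" for N
  proof -
    have "subspace N" using N(1) by (simp add: subsupermodule_def)
    then obtain z p where z: "z \<in> N" "z \<in> mpart V p" "z \<noteq> 0"
      using exists_homogeneous[of N] N unfolding subsupermodule_def by metis
    obtain x where x: "x \<in> carrier A" "act V x z \<in> mpart V (p + 1)" "act V x z \<noteq> 0"
      using swap[OF z(2,3)] by blast
    have "act V x z \<in> N" using N(1) x(1) z(1) by (auto simp: subsupermodule_def)
    then have "span {z, act V x z} \<subseteq> N" using z(1) \<open>subspace N\<close> by (intro span_minimal) auto
    moreover have "span {z, act V x z} = UNIV"
      using opposite_parity_dim(2)[OF _ z(2) x(2) z(3) x(3)] V(2) by simp
    ultimately show ?thesis by blast
  qed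
  ultimately show ?thesis using V(1) unfolding irreducible_supermodule_def by blast
qed

locale odd_root = super_space scale part
  for scale :: "complex \<Rightarrow> 'v::ab_group_add \<Rightarrow> 'v" and part :: "bit \<Rightarrow> 'v set" +
  fixes T :: "'v \<Rightarrow> 'v"
  assumes T_linear: "Vector_Spaces.linear scale scale T"
    and T_odd: "z \<in> part p \<Longrightarrow> T z \<in> part (p + 1)"
    and T_square: "T (T z) = scale (1/2) z"
begin

lemmas T_simps [simp] = lin_add[OF T_linear] lin_scale[OF T_linear] lin_diff[OF T_linear] lin_zero[OF T_linear]
  module_hom.neg[OF Vector_Spaces.linear.axioms(3)[OF T_linear]]

lemma T_eq_0_iff [simp]: "T z = 0 \<longleftrightarrow> z = 0"
  using T_square[of z] by auto

lemma T_bij: "bij T"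
proof (rule o_bij)
  show "(\<lambda>z. scale 2 (T z)) \<circ> T = id" "T \<circ> (\<lambda>z. scale 2 (T z)) = id"
    by (auto simp: T_square)
qed

lemma dim_ge_2:
  assumes "0 < dim UNIV"
  shows "2 \<le> dim UNIV"
proof -
  have "(UNIV :: 'v set) \<noteq> {0}" using assms by (rule UNIV_nontrivial_if_dim_pos)
  then obtain x p where "x \<in> part p" "x \<noteq> 0"
    using exists_homogeneous[of UNIV] part_decomp by auto
  then show ?thesis using opposite_parity_dim(1)[OF assms _ T_odd] by auto
qed

text \<open>The homogeneous parts are one-dimensional: \<open>{x, T x}\<close> is a basis, and a homogeneous vector has no
  component of the other parity.\<close>

lemma part_eq_span:
  assumes dim2: "dim UNIV = 2" and x: "x \<in> part p" "x \<noteq> 0" and y: "y \<in> part p"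
  shows "\<exists>k. y = scale k x"
proof -
  have "y \<in> span {T x, x}"
    using opposite_parity_dim(2)[OF _ x(1) T_odd[OF x(1)] x(2)] dim2 x(2)
    by (simp add: insert_commute)
  then obtain k where "y - scale k (T x) \<in> span {x}" unfolding span_breakdown_eq by blast
  then obtain l where l: "y - scale k (T x) = scale l x" by (auto simp: span_singleton)
  have "scale k (T x) = y - scale l x" using l by (simp add: algebra_simps)
  then have "scale k (T x) \<in> part p"
    using y x(1) by (simp add: subspace_diff[OF subspace_part] subspace_scale[OF subspace_part])
  moreover have "scale k (T x) \<in> part (p + 1)"
    using T_odd[OF x(1)] subspace_scale[OF subspace_part] by blast
  ultimately have "scale k (T x) = 0" by (rule part_inter)
  with l show ?thesis by (intro exI[of _ l]) simp
qed

end

text \<open>\<open>S\<close> models the action of an odd element of \<open>W'\<close>, and \<open>T\<close> that of \<open>\<Theta>\<close>.\<close>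

locale odd_anticommuting = odd_root scale part T
  for scale :: "complex \<Rightarrow> 'v::ab_group_add \<Rightarrow> 'v" and part :: "bit \<Rightarrow> 'v set" and T +
  fixes S :: "'v \<Rightarrow> 'v"
  assumes dim2: "dim UNIV = 2"
    and S_linear: "Vector_Spaces.linear scale scale S"
    and S_odd: "z \<in> part p \<Longrightarrow> S z \<in> part (p + 1)"
    and anticommute: "S (T z) = - T (S z)"
    and S_nonzero: "\<exists>z. S z \<noteq> 0"
begin

lemmas S_simps [simp] = lin_add[OF S_linear] lin_scale[OF S_linear] lin_diff[OF S_linear] lin_zero[OF S_linear]

lemma homogeneous_generator: obtains x p where "x \<in> part p" "x \<noteq> 0" "S x \<noteq> 0"
proof -
  obtain z where z: "S z \<noteq> 0" using S_nonzero by blast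
  obtain a b where "a \<in> part 0" "b \<in> part 1" "z = a + b" using part_decomp by blast
  with z have "S a \<noteq> 0 \<or> S b \<noteq> 0" by auto
  then show ?thesis
    using that \<open>a \<in> part 0\<close> \<open>b \<in> part 1\<close> lin_zero[OF S_linear] by metis
qed

text \<open>If \<open>S x = c T x\<close>, then anticommutation gives \<open>S (T x) = - (c/2) x\<close>, so \<open>S\<^sup>2 = - c\<^sup>2/2\<close>.\<close>

lemma S_injective: "S z = 0 \<Longrightarrow> z = 0"
proof -
  obtain x p where x: "x \<in> part p" "x \<noteq> 0" "S x \<noteq> 0" by (rule homogeneous_generator)
  \<comment> \<open>\<open>T x\<close> spans the part that contains \<open>S x\<close>.\<close>
  obtain c where c: "S x = scale c (T x)"
    using part_eq_span[OF dim2 T_odd[OF x(1)] _ S_odd[OF x(1)]] x(2) by auto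
  have STx: "S (T x) = scale (- c / 2) x"
    by (simp add: anticommute c T_square scale_minus_left)
  have c0: "c \<noteq> 0" using c x(3) by auto
  have "S (S z) = scale (- c * c / 2) z"
  proof -
    have "z \<in> span {x, T x}"
      using opposite_parity_dim(2)[OF _ x(1) T_odd[OF x(1)] x(2)] dim2 x(2) by simp
    then obtain k where "z - scale k x \<in> span {T x}" unfolding span_breakdown_eq by blast
    then obtain l where "z - scale k x = scale l (T x)" by (auto simp: span_singleton)
    then have "z = scale k x + scale l (T x)" by (simp add: algebra_simps)
    then show ?thesis by (simp add: c STx scale_right_distrib mult_ac)
  qed
  with c0 show "S z = 0 \<Longrightarrow> z = 0" by simp
qed

text \<open>\<open>\<sigma> x = k x\<close> by one-dimensionality of the homogeneous parts, and the commutation with \<open>S\<close> carries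
  the scalar over to \<open>S x\<close>, which spans the other part.\<close>

lemma even_commuting_scalar:
  assumes \<sigma>: "Vector_Spaces.linear scale scale \<sigma>" "\<And>p z. z \<in> part p \<Longrightarrow> \<sigma> z \<in> part p"
    and comm: "\<And>z. \<sigma> (S z) = S (\<sigma> z)"
  shows "\<exists>k. \<sigma> = scale k"
proof -
  note [simp] = lin_add[OF \<sigma>(1)] lin_scale[OF \<sigma>(1)]
  obtain x p where x: "x \<in> part p" "x \<noteq> 0" "S x \<noteq> 0" by (rule homogeneous_generator)
  obtain k where k: "\<sigma> x = scale k x" using part_eq_span[OF dim2 x(1,2)] \<sigma>(2)[OF x(1)] by blast
  have "\<sigma> z = scale k z" for z
  proof -
    have "z \<in> span {x, S x}"
      using opposite_parity_dim(2)[OF _ x(1) S_odd[OF x(1)] x(2,3)] dim2 by simp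
    then obtain i where "z - scale i x \<in> span {S x}" unfolding span_breakdown_eq by blast
    then obtain l where "z - scale i x = scale l (S x)" by (auto simp: span_singleton)
    then have "z = scale i x + scale l (S x)" by (simp add: algebra_simps)
    then show ?thesis by (simp add: k comm scale_right_distrib mult.commute)
  qed
  then show ?thesis by blast
qed

end

text \<open>Composition with \<open>T\<close> turns an odd endomorphism into an even linear map that commutes with \<open>S\<close>, hence
  into a scalar. So the odd endomorphisms are the multiples of \<open>T\<close>, and the even ones are scalars.\<close>

lemma type_Q_if_odd_root:
  fixes V :: "('a, 'v::ab_group_add) supermod"
  assumes V: "supermodule A V" "mdim V = 2"
    and apart: "\<And>p. apart A p \<subseteq> carrier A"
    and T: "T \<in> End_part A V 1" "\<And>z. T (T z) = mscale V (1/2) z"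
    and x: "x \<in> apart A 1" "act V x y \<noteq> 0"
  shows "type_Q A V"
proof -
  have xc: "x \<in> carrier A" using x(1) apart by blast
  interpret super_space "mscale V" "mpart V" using V(1) by (rule supermodule_super_space)
  interpret odd_anticommuting "mscale V" "mpart V" T "act V x"
  proof (intro odd_anticommuting.intro odd_root.intro odd_root_axioms.intro
      odd_anticommuting_axioms.intro super_space_axioms)
    show "Vector_Spaces.linear (mscale V) (mscale V) T" using T(1) by (simp add: End_part_def)
    show "T z \<in> mpart V (p + 1)" if "z \<in> mpart V p" for p z
      using T(1) that by (auto simp: End_part_def add.commute[of p] simp del: add_bit_eq_xor)
    show "Vector_Spaces.linear (mscale V) (mscale V) (act V x)"
      using V(1) xc by (simp add: supermodule_def)
    show "act V x z \<in> mpart V (p + 1)" if "z \<in> mpart V p" for p z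
      using V(1) x(1) that unfolding supermodule_def add.commute[of p] by blast
    have "T (act V x z) = mscale V (koszul 1 1) (act V x (T z))" for z
      using T(1) x(1) unfolding End_part_def by blast
    then show "act V x (T z) = - T (act V x z)" for z
      by (simp add: koszul_def)
  qed (use T(2) V(2) x(2) in auto)
  have "irreducible_supermodule A V"
    using V xc S_odd S_injective by (intro irreducible_supermodule_if_parity_swapped) blast+
  moreover have "vector_space.dim (\<lambda>c (\<tau> :: 'v \<Rightarrow> 'v) z. mscale V c (\<tau> z)) (End_super A V) = 2"
  proof -
    interpret F: vector_space "\<lambda>c (\<tau> :: 'v \<Rightarrow> 'v) z. mscale V c (\<tau> z)"
      by unfold_locales
        (simp_all add: fun_eq_iff scale_right_distrib scale_left_distrib)
    have ev: "\<exists>k. \<sigma> = mscale V k" if "\<sigma> \<in> End_part A V 0" for \<sigma>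
    proof (rule even_commuting_scalar)
      show "\<sigma> (act V x z) = act V x (\<sigma> z)" for z
        using that x(1) by (auto simp: End_part_def koszul_def)
    qed (use that in \<open>auto simp: End_part_def simp del: add_bit_eq_xor\<close>)
    have od: "\<exists>k. \<tau> = (\<lambda>z. mscale V k (T z))" if "\<tau> \<in> End_part A V 1" for \<tau>
    proof -
      have \<tau>: "Vector_Spaces.linear (mscale V) (mscale V) \<tau>"
        "\<And>p z. z \<in> mpart V p \<Longrightarrow> \<tau> z \<in> mpart V (1 + p)"
        using that by (auto simp: End_part_def simp del: add_bit_eq_xor)
      have "\<exists>k. T \<circ> \<tau> = mscale V k"
      proof (rule even_commuting_scalar)
        show "Vector_Spaces.linear (mscale V) (mscale V) (T \<circ> \<tau>)"
          by (rule Vector_Spaces.linear_compose[OF \<tau>(1) T_linear])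
        show "(T \<circ> \<tau>) z \<in> mpart V p" if "z \<in> mpart V p" for p z
          using T_odd[OF \<tau>(2)[OF that]] bit_cases[of p] by auto
        have "\<tau> (act V x z) = mscale V (koszul 1 1) (act V x (\<tau> z))" for z
          using that x(1) unfolding End_part_def by blast
        then show "(T \<circ> \<tau>) (act V x z) = act V x ((T \<circ> \<tau>) z)" for z
          by (simp add: koszul_def anticommute)
      qed
      then obtain k where k: "\<And>z. T (\<tau> z) = mscale V k z" by (auto simp: fun_eq_iff)
      have "\<tau> z = mscale V (2 * k) (T z)" for z
      proof -
        have "\<tau> z = mscale V 2 (T (T (\<tau> z)))" by (simp add: T_square)
        then show ?thesis by (simp add: k)
      qed
      then show ?thesis by blast
    qed
    have act_scale: "act V y (mscale V k z) = mscale V k (act V y z)" if "y \<in> apart A p" for y p k z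
    proof -
      have "Vector_Spaces.linear (mscale V) (mscale V) (act V y)"
        using V(1) apart that unfolding supermodule_def by blast
      then show ?thesis by (rule lin_scale)
    qed
    have scale_linear: "Vector_Spaces.linear (mscale V) (mscale V) (mscale V k)" for k
      by (rule linear_scale_self)
    have idE: "mscale V k \<in> End_part A V 0" for k
      using subspace_scale[OF subspace_part] scale_linear act_scale
      by (auto simp: End_part_def koszul_def)
    have TE: "(\<lambda>z. mscale V k (T z)) \<in> End_part A V 1" for k
      unfolding End_part_def
    proof (intro CollectI conjI allI ballI)
      show "Vector_Spaces.linear (mscale V) (mscale V) (\<lambda>z. mscale V k (T z))"
        using Vector_Spaces.linear_compose[OF T_linear scale_linear[of k]] by (simp add: o_def)
      show "mscale V k (T z) \<in> mpart V (1 + p)" if "z \<in> mpart V p" for p z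
        using T_odd[OF that] subspace_scale[OF subspace_part] unfolding add.commute[of 1] by blast
      show "mscale V k (T (act V y z)) = mscale V (koszul 1 p) (act V y (mscale V k (T z)))"
        if y: "y \<in> apart A p" for p y z
      proof -
        have "T (act V y z) = mscale V (koszul 1 p) (act V y (T z))"
          using T(1) y unfolding End_part_def by blast
        then show ?thesis by (simp add: act_scale[OF y] mult.commute)
      qed
    qed
    have "End_super A V = F.span {id, T}"
    proof (intro equalityI subsetI)
      fix \<rho> assume "\<rho> \<in> End_super A V"
      then obtain \<sigma> \<tau> where "\<rho> = \<sigma> + \<tau>" "\<sigma> \<in> End_part A V 0" "\<tau> \<in> End_part A V 1"
        by (auto simp: End_super_def)
      moreover obtain k l where "\<sigma> = (\<lambda>z. mscale V k (id z))" "\<tau> = (\<lambda>z. mscale V l (T z))"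
        using ev[of \<sigma>] od[of \<tau>] calculation by auto
      moreover have "(\<lambda>z. mscale V k (id z)) + (\<lambda>z. mscale V l (T z)) \<in> F.span {id, T}"
        using F.span_add[OF F.span_scale[OF F.span_base[of id "{id, T}"], of k]
            F.span_scale[OF F.span_base[of T "{id, T}"], of l]] by simp
      ultimately show "\<rho> \<in> F.span {id, T}" by simp
    next
      fix \<rho> assume "\<rho> \<in> F.span {id, T}"
      then obtain k where "\<rho> - (\<lambda>z. mscale V k (id z)) \<in> F.span {T}"
        unfolding F.span_breakdown_eq by blast
      then obtain l where "\<rho> - (\<lambda>z. mscale V k (id z)) = (\<lambda>z. mscale V l (T z))"
        by (auto simp: F.span_singleton)
      then have "\<rho> = mscale V k + (\<lambda>z. mscale V l (T z))"
        by (auto simp: fun_eq_iff diff_eq_eq add.commute)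
      then show "\<rho> \<in> End_super A V" using idE TE unfolding End_super_def by blast
    qed
    moreover have "F.independent {id, T}" "id \<noteq> T"
    proof -
      obtain z p where z: "z \<in> mpart V p" "z \<noteq> 0" by (rule homogeneous_generator)
      have T0: "T \<noteq> 0" using z(2) T_eq_0_iff[of z] by (auto simp: fun_eq_iff)
      have nin: "id \<notin> F.span {T}"
      proof
        assume "id \<in> F.span {T}"
        then obtain k where "id = (\<lambda>z. mscale V k (T z))" by (auto simp: F.span_singleton)
        then have "z = mscale V k (T z)" by (metis id_apply)
        then have "z \<in> mpart V (p + 1)" using T_odd[OF z(1)] subspace_scale[OF subspace_part] by metis
        with z show False using part_inter by blast
      qed
      then show "id \<noteq> T" by (auto intro: F.span_base)
      with T0 nin show "F.independent {id, T}" by (simp add: F.independent_insert F.dependent_single)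
    qed
    ultimately show ?thesis by (simp add: F.dim_eq_card_independent)
  qed
  ultimately show ?thesis by (simp add: type_Q_def)
qed

section \<open>The action of the odd generator\<close>

context odd_whittaker
begin

lemma supermodule_restrict:
  assumes "supermodule U V"
  shows "supermodule W' V"
  using assms refined_subset unfolding supermodule_def refined_operations by blast

lemma theta_acts_as_odd_root:
  assumes V: "supermodule U V"
  shows "odd_root (mscale V) (mpart V) (act V \<Theta>)"
proof (intro odd_root.intro odd_root_axioms.intro)
  show "super_space (mscale V) (mpart V)" using V by (rule supermodule_super_space)
  show "Vector_Spaces.linear (mscale V) (mscale V) (act V \<Theta>)"
    using V theta_carrier unfolding supermodule_def by blast
  show "act V \<Theta> z \<in> mpart V (p + 1)" if "z \<in> mpart V p" for p z
    using V theta_odd that unfolding supermodule_def add.commute[of p] by blast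
  have "act V \<Theta> (act V \<Theta> z) = act V (\<Theta> \<otimes>\<^bsub>U\<^esub> \<Theta>) z" for z
    using V theta_carrier unfolding supermodule_def by metis
  also have "act V (\<Theta> \<otimes>\<^bsub>U\<^esub> \<Theta>) z = mscale V (1/2) (act V \<one>\<^bsub>U\<^esub> z)" for z
    using V one_carrier unfolding theta_square supermodule_def by blast
  also have "act V \<one>\<^bsub>U\<^esub> z = z" for z
    using V unfolding supermodule_def by blast
  finally show "act V \<Theta> (act V \<Theta> z) = mscale V (1/2) z" for z .
qed

lemma theta_supercommutes:
  assumes V: "supermodule U V" and X: "X \<in> apart W' p"
  shows "act V \<Theta> (act V X z) = mscale V (koszul 1 p) (act V X (act V \<Theta> z))"
proof -
  interpret V: super_space "mscale V" "mpart V" using V by (rule supermodule_super_space)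
  have XU: "X \<in> carrier U" using X refined_subset(2) apart_subset_carrier by blast
  have "act V X (act V \<Theta> z) = act V (X \<otimes>\<^bsub>U\<^esub> \<Theta>) z"
    using V XU theta_carrier unfolding supermodule_def by metis
  also have "\<dots> = act V (koszul 1 p \<odot>\<^bsub>U\<^esub> \<Theta>) (act V X z)"
    using V XU smult_theta_carrier unfolding refined_supercommutes_theta[OF X] supermodule_def by blast
  also have "\<dots> = mscale V (koszul 1 p) (act V \<Theta> (act V X z))"
    using V theta_carrier unfolding supermodule_def by blast
  finally have "act V X (act V \<Theta> z) = mscale V (koszul 1 p) (act V \<Theta> (act V X z))" .
  then show ?thesis by (simp add: koszul_def)
qed

lemma theta_odd_automorphism:
  assumes V: "supermodule U V"
  shows "odd_automorphism W' V (act V \<Theta>)"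
proof -
  interpret V: odd_root "mscale V" "mpart V" "act V \<Theta>" by (rule theta_acts_as_odd_root[OF V])
  have "act V \<Theta> \<in> End_part W' V 1"
    unfolding End_part_def
    using V.T_linear V.T_odd theta_supercommutes[OF V] by (simp add: add.commute[of 1] del: add_bit_eq_xor)
  then show ?thesis using V.T_bij by (simp add: odd_automorphism_def)
qed

end

theorem proposition4p2:
  fixes L :: "'g::ab_group_add lie_super"
    and B :: "'g \<Rightarrow> 'g \<Rightarrow> complex"
    and e h f :: 'g
    and u v :: "nat \<Rightarrow> 'g"
    and s r :: nat
    and U W' :: "'g env set superalg"
    and V :: "('g env set, 'v::ab_group_add) supermod"
  assumes "basic_lie_superalgebra L"
    and "invariant_form L B"
    and "ad_nilpotent L e"
    and "sl2_triple L e h f"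
    and "B e f = 1"
    and "odd (int (ldim L (lpart L 1)) - int (ldim L (centralizer L e \<inter> lpart L 1)))"
    and "symplectic_basis L (B e) h s u"
    and "symmetric_basis L (B e) h r v"
    and U: "U = finite_W L (B e) h s u r v"
    and W': "W' = refined_W L (B e) h s u r v"
    and "supermodule U V"
    and "mdim V = 2"
  shows "irreducible_supermodule U V \<and>
    (\<forall>M :: ('g env set, 'w::ab_group_add) supermod.
       supermodule U M \<and> 0 < mdim M \<longrightarrow> mdim V \<le> mdim M) \<and>
    supermodule W' V \<and>
    (\<exists>\<tau>. odd_automorphism W' V \<tau>) \<and>
    (type_Q W' V \<or> (\<forall>x\<in>apart W' 1. \<forall>y. act V x y = 0))"
proof -
  interpret super_lie L
    using assms(1) by unfold_locales (simp add: basic_lie_superalgebra_def)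
  interpret odd_whittaker L B e h f u v s r
    using assms by unfold_locales (simp_all add: basic_lie_superalgebra_def)
  have V: "supermodule (finite_W L (B e) h s u r v) V" and dimV: "mdim V = 2"
    using assms(11,12) U by simp_all
  interpret V: odd_root "mscale V" "mpart V" "act V \<Theta>" by (rule theta_acts_as_odd_root[OF V])
  have WV: "supermodule W' V" using supermodule_restrict[OF V] W' by simp
  have "irreducible_supermodule U V"
    unfolding U
  proof (rule irreducible_supermodule_if_parity_swapped[OF V dimV])
    fix p z assume "z \<in> mpart V p" "z \<noteq> 0"
    then show "\<exists>x\<in>carrier (finite_W L (B e) h s u r v).
        act V x z \<in> mpart V (p + 1) \<and> act V x z \<noteq> 0"
      using V.T_odd by (intro bexI[of _ \<Theta>] theta_carrier conjI) simp_all
  qed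
  moreover have "mdim V \<le> mdim M" if "supermodule U M" "0 < mdim M"
    for M :: "('g env set, 'w) supermod"
    using odd_root.dim_ge_2[OF theta_acts_as_odd_root[of M]] that dimV U by simp
  moreover have theta: "odd_automorphism W' V (act V \<Theta>)"
    using theta_odd_automorphism[OF V] W' by simp
  moreover have "type_Q W' V" if "x \<in> apart W' 1" "act V x y \<noteq> 0" for x y
  proof (rule type_Q_if_odd_root[OF WV dimV _ _ V.T_square that])
    show "apart W' p \<subseteq> carrier W'" for p by (auto simp: W' refined_W_def invariants_def)
    show "act V \<Theta> \<in> End_part W' V 1" using theta by (simp add: odd_automorphism_def)
  qed
  ultimately show ?thesis using WV by blast
qed

end
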